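(* The disjoint union $*\sqcup *$ of two copies of the terminal category is not a $0$-concrete $(\infty,1)$-category. Explicitly: there is no $0$-concrete $(\infty,1)$-category $(\mathrm{obj},\mathrm{obj}^+,\hom,\mathrm{conf})$ whose type of objects $\mathrm{obj}$ is the two-element type with elements $x,y$ and such that $\hom(x,x)$ and $\hom(y,y)$ are contractible while $\hom(x,y)$ and $\hom(y,x)$ are empty (that is, $\neg\hom(x,y)$ and $\neg\hom(y,x)$ hold).
   Context: We work in homotopy type theory (as in the HoTT book), with $\mathrm{Type}$ a universe of types; excluded middle is not assumed. Universe levels are not emphasised. A $0$-concrete $(\infty,1)$-category (intuitively, a full subcategory of the category of types) consists of: a type $\mathrm{obj}$ of objects; an object realisation map $\mathrm{obj}^+:\mathrm{obj}\to\mathrm{Type}$; a family $\hom:\mathrm{obj}\to\mathrm{obj}\to\mathrm{Type}$; and for all $x,y:\mathrm{obj}$ an equivalence $\mathrm{conf}(x,y):\hom(x,y)\simeq\bigl(\mathrm{obj}^+(x)\to\mathrm{obj}^+(y)\bigr)$. The terminal category $*$ has one object, whose type of endomorphisms is contractible. In a disjoint union of categories there are no morphisms between objects from different summands. *)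

theory Defs
  imports Main
begin

text \<open>
  The formal type theory of the HoTT book (second presentation in its appendix, including function
  extensionality, univalence and the circle), deeply embedded.  ``HoTT proves that the type \<open>A\<close> is
  inhabited'' is derivability of \<open>[] \<turnstile> t \<^bold>: A\<close> for some raw term \<open>t\<close>.  A shallow reading of types as
  HOL sets would be classical and 0-truncated, and a higher-order encoding with HOL functions as
  binders would validate a form of excluded middle, so the object syntax is kept separate from HOL.
\<close>

subsection \<open>Raw terms\<close>

text \<open>
  De Bruijn indices; index 0 is the innermost binder.  The number of variables bound in an argument
  is visible in the substitution functions below.  In \<open>IndX C \<dots> t\<close> the first argument is the motive,
  the last one the eliminated term; in \<open>IndId C c a b p\<close> the motive binds \<open>x, y, p\<close> (indices 2, 1, 0).
\<close>

datatype tm =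
    Var nat
  | Uni nat
  | Pi tm tm
  | Lam tm tm
  | App tm tm
  | Sig tm tm
  | Pr tm tm
  | IndSig tm tm tm
  | Plus tm tm
  | InL tm
  | InR tm
  | IndPlus tm tm tm tm
  | Empty
  | IndEmpty tm tm
  | One
  | Star
  | IndOne tm tm tm
  | Nat
  | Zero
  | Succ tm
  | IndNat tm tm tm tm
  | Id tm tm tm
  | Refl tm
  | IndId tm tm tm tm tm
  | Funext tm tm
  | Univalence nat tm tm
  | Circle
  | Base
  | Loop
  | IndCircle tm tm tm tm
  | LoopComp tm tm tm

abbreviation scons :: "'a \<Rightarrow> (nat \<Rightarrow> 'a) \<Rightarrow> nat \<Rightarrow> 'a"  (infixr "\<bullet>" 70)
  where "a \<bullet> f \<equiv> case_nat a f"

definition upr :: "(nat \<Rightarrow> nat) \<Rightarrow> nat \<Rightarrow> nat"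
  where "upr r = 0 \<bullet> (\<lambda>n. Suc (r n))"

primrec ren :: "(nat \<Rightarrow> nat) \<Rightarrow> tm \<Rightarrow> tm" where
  "ren r (Var n) = Var (r n)"
| "ren r (Uni i) = Uni i"
| "ren r (Pi A B) = Pi (ren r A) (ren (upr r) B)"
| "ren r (Lam A b) = Lam (ren r A) (ren (upr r) b)"
| "ren r (App f a) = App (ren r f) (ren r a)"
| "ren r (Sig A B) = Sig (ren r A) (ren (upr r) B)"
| "ren r (Pr a b) = Pr (ren r a) (ren r b)"
| "ren r (IndSig C g p) = IndSig (ren (upr r) C) (ren (upr (upr r)) g) (ren r p)"
| "ren r (Plus A B) = Plus (ren r A) (ren r B)"
| "ren r (InL a) = InL (ren r a)"
| "ren r (InR b) = InR (ren r b)"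
| "ren r (IndPlus C c d e) =
     IndPlus (ren (upr r) C) (ren (upr r) c) (ren (upr r) d) (ren r e)"
| "ren r Empty = Empty"
| "ren r (IndEmpty C a) = IndEmpty (ren (upr r) C) (ren r a)"
| "ren r One = One"
| "ren r Star = Star"
| "ren r (IndOne C c a) = IndOne (ren (upr r) C) (ren r c) (ren r a)"
| "ren r Nat = Nat"
| "ren r Zero = Zero"
| "ren r (Succ n) = Succ (ren r n)"
| "ren r (IndNat C c d n) =
     IndNat (ren (upr r) C) (ren r c) (ren (upr (upr r)) d) (ren r n)"
| "ren r (Id A a b) = Id (ren r A) (ren r a) (ren r b)"
| "ren r (Refl a) = Refl (ren r a)"
| "ren r (IndId C c a b p) =
     IndId (ren (upr (upr (upr r))) C) (ren (upr r) c) (ren r a) (ren r b) (ren r p)"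
| "ren r (Funext f g) = Funext (ren r f) (ren r g)"
| "ren r (Univalence i A B) = Univalence i (ren r A) (ren r B)"
| "ren r Circle = Circle"
| "ren r Base = Base"
| "ren r Loop = Loop"
| "ren r (IndCircle C b l p) = IndCircle (ren (upr r) C) (ren r b) (ren r l) (ren r p)"
| "ren r (LoopComp C b l) = LoopComp (ren (upr r) C) (ren r b) (ren r l)"

definition wk :: "nat \<Rightarrow> tm \<Rightarrow> tm"
  where "wk k = ren (\<lambda>n. n + k)"

text \<open>Weakening below one binder, for families.\<close>

definition wkf :: "nat \<Rightarrow> tm \<Rightarrow> tm"
  where "wkf k = ren (upr (\<lambda>n. n + k))"

definition up :: "(nat \<Rightarrow> tm) \<Rightarrow> nat \<Rightarrow> tm"
  where "up s = Var 0 \<bullet> (\<lambda>n. wk 1 (s n))"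

primrec subst :: "(nat \<Rightarrow> tm) \<Rightarrow> tm \<Rightarrow> tm" where
  "subst s (Var n) = s n"
| "subst s (Uni i) = Uni i"
| "subst s (Pi A B) = Pi (subst s A) (subst (up s) B)"
| "subst s (Lam A b) = Lam (subst s A) (subst (up s) b)"
| "subst s (App f a) = App (subst s f) (subst s a)"
| "subst s (Sig A B) = Sig (subst s A) (subst (up s) B)"
| "subst s (Pr a b) = Pr (subst s a) (subst s b)"
| "subst s (IndSig C g p) = IndSig (subst (up s) C) (subst (up (up s)) g) (subst s p)"
| "subst s (Plus A B) = Plus (subst s A) (subst s B)"
| "subst s (InL a) = InL (subst s a)"
| "subst s (InR b) = InR (subst s b)"
| "subst s (IndPlus C c d e) =
     IndPlus (subst (up s) C) (subst (up s) c) (subst (up s) d) (subst s e)"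
| "subst s Empty = Empty"
| "subst s (IndEmpty C a) = IndEmpty (subst (up s) C) (subst s a)"
| "subst s One = One"
| "subst s Star = Star"
| "subst s (IndOne C c a) = IndOne (subst (up s) C) (subst s c) (subst s a)"
| "subst s Nat = Nat"
| "subst s Zero = Zero"
| "subst s (Succ n) = Succ (subst s n)"
| "subst s (IndNat C c d n) =
     IndNat (subst (up s) C) (subst s c) (subst (up (up s)) d) (subst s n)"
| "subst s (Id A a b) = Id (subst s A) (subst s a) (subst s b)"
| "subst s (Refl a) = Refl (subst s a)"
| "subst s (IndId C c a b p) =
     IndId (subst (up (up (up s))) C) (subst (up s) c) (subst s a) (subst s b) (subst s p)"
| "subst s (Funext f g) = Funext (subst s f) (subst s g)"
| "subst s (Univalence i A B) = Univalence i (subst s A) (subst s B)"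
| "subst s Circle = Circle"
| "subst s Base = Base"
| "subst s Loop = Loop"
| "subst s (IndCircle C b l p) =
     IndCircle (subst (up s) C) (subst s b) (subst s l) (subst s p)"
| "subst s (LoopComp C b l) = LoopComp (subst (up s) C) (subst s b) (subst s l)"

abbreviation sub1 :: "tm \<Rightarrow> tm \<Rightarrow> tm"
  where "sub1 a \<equiv> subst (a \<bullet> Var)"

abbreviation sub2 :: "tm \<Rightarrow> tm \<Rightarrow> tm \<Rightarrow> tm"
  where "sub2 a b \<equiv> subst (b \<bullet> a \<bullet> Var)"

abbreviation sub3 :: "tm \<Rightarrow> tm \<Rightarrow> tm \<Rightarrow> tm \<Rightarrow> tm"
  where "sub3 a b c \<equiv> subst (c \<bullet> b \<bullet> a \<bullet> Var)"

text \<open>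
  \<open>reix k a C\<close>: the motive \<open>C\<close> binds one variable over a context; the result lives over \<open>k\<close>
  further variables, with \<open>a\<close> in place of the bound one.
\<close>

definition reix :: "nat \<Rightarrow> tm \<Rightarrow> tm \<Rightarrow> tm"
  where "reix k a = subst (a \<bullet> (\<lambda>n. Var (n + k)))"

subsection \<open>Derived type formers\<close>

definition Arr :: "tm \<Rightarrow> tm \<Rightarrow> tm"
  where "Arr A B = Pi A (wk 1 B)"

definition Prod :: "tm \<Rightarrow> tm \<Rightarrow> tm"
  where "Prod A B = Sig A (wk 1 B)"

definition Neg :: "tm \<Rightarrow> tm"
  where "Neg A = Arr A Empty"

definition Two :: tm
  where "Two = Plus One One"

definition isContr :: "tm \<Rightarrow> tm"
  where "isContr A = Sig A (Pi (wk 1 A) (Id (wk 2 A) (Var 1) (Var 0)))"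

text \<open>Bi-invertibility: a map \<open>g\<close> with \<open>f \<circ> g \<sim> id\<close> and a map \<open>h\<close> with \<open>h \<circ> f \<sim> id\<close>.\<close>

definition isEquiv :: "tm \<Rightarrow> tm \<Rightarrow> tm \<Rightarrow> tm"
  where "isEquiv A B f =
    Prod (Sig (Arr B A) (Pi (wk 1 B) (Id (wk 2 B) (App (wk 2 f) (App (Var 1) (Var 0))) (Var 0))))
         (Sig (Arr B A) (Pi (wk 1 A) (Id (wk 2 A) (App (Var 1) (App (wk 2 f) (Var 0))) (Var 0))))"

definition Equiv :: "tm \<Rightarrow> tm \<Rightarrow> tm"
  where "Equiv A B = Sig (Arr A B) (isEquiv (wk 1 A) (wk 1 B) (Var 0))"

definition idEquiv :: "tm \<Rightarrow> tm"
  where "idEquiv A =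
    (let inv = Pr (Lam A (Var 0)) (Lam A (Refl (Var 0))) in Pr (Lam A (Var 0)) (Pr inv inv))"

text \<open>In the next two definitions \<open>B\<close> is a family over \<open>A\<close>, i.e. it binds one variable.\<close>

definition Htpy :: "tm \<Rightarrow> tm \<Rightarrow> tm \<Rightarrow> tm \<Rightarrow> tm"
  where "Htpy A B f g = Pi A (Id B (App (wk 1 f) (Var 0)) (App (wk 1 g) (Var 0)))"

definition happly :: "tm \<Rightarrow> tm \<Rightarrow> tm \<Rightarrow> tm \<Rightarrow> tm"
  where "happly A B f g =
    Lam (Id (Pi A B) f g)
      (IndId (Htpy (wk 4 A) (wkf 4 B) (Var 2) (Var 1))
             (Lam (wk 2 A) (Refl (App (Var 1) (Var 0))))
             (wk 1 f) (wk 1 g) (Var 0))"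

definition idtoeqv :: "nat \<Rightarrow> tm \<Rightarrow> tm \<Rightarrow> tm"
  where "idtoeqv i A B =
    Lam (Id (Uni i) A B)
      (IndId (Equiv (Var 2) (Var 1)) (idEquiv (Var 0)) (wk 1 A) (wk 1 B) (Var 0))"

text \<open>
  Transport in the family \<open>C\<close> and dependent application of \<open>f\<close>, a section of \<open>C\<close>, along \<open>p\<close>, an
  identification of \<open>a\<close> with \<open>b\<close>.
\<close>

definition transp :: "tm \<Rightarrow> tm \<Rightarrow> tm \<Rightarrow> tm \<Rightarrow> tm"
  where "transp C a b p =
    IndId (Arr (reix 3 (Var 2) C) (reix 3 (Var 1) C)) (Lam C (Var 0)) a b p"

definition apd :: "tm \<Rightarrow> tm \<Rightarrow> tm \<Rightarrow> tm \<Rightarrow> tm \<Rightarrow> tm"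
  where "apd C f a b p =
    IndId (Id (reix 3 (Var 1) C)
              (App (transp (wkf 3 C) (Var 2) (Var 1) (Var 0)) (App (wk 3 f) (Var 2)))
              (App (wk 3 f) (Var 1)))
          (Refl (App (wk 1 f) (Var 0))) a b p"

subsection \<open>Judgements\<close>

text \<open>
  Contexts list the most recent variable first.  Universes are Russell-style and cumulative.
  Weakening and substitution are not rules, being admissible.  In \<open>id_elim\<close> the substitution
  \<open>Refl (Var 0) \<bullet> Var 0 \<bullet> Var\<close> sends \<open>x, y, p\<close> to \<open>z, z, refl z\<close>: the tail \<open>Var\<close> maps \<open>x\<close> to
  \<open>z = Var 0\<close> and the ambient variables to themselves, shifted past \<open>z\<close>.
\<close>

type_synonym cxt = "tm list"

inductive
  is_cxt :: "cxt \<Rightarrow> bool"  ("_ ctx" [60] 50) and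
  typing :: "cxt \<Rightarrow> tm \<Rightarrow> tm \<Rightarrow> bool"  ("_ \<turnstile> _ \<^bold>: _" [51, 51, 51] 50) and
  jeq :: "cxt \<Rightarrow> tm \<Rightarrow> tm \<Rightarrow> tm \<Rightarrow> bool"  ("_ \<turnstile> _ \<cong> _ \<^bold>: _" [51, 51, 51, 51] 50)
where
  ctx_emp: "[] ctx"
| ctx_ext: "\<G> \<turnstile> A \<^bold>: Uni i \<Longrightarrow> (A # \<G>) ctx"

| var: "\<G> ctx \<Longrightarrow> n < length \<G> \<Longrightarrow> \<G> \<turnstile> Var n \<^bold>: wk (Suc n) (\<G> ! n)"

| eq_refl: "\<G> \<turnstile> a \<^bold>: A \<Longrightarrow> \<G> \<turnstile> a \<cong> a \<^bold>: A"
| eq_sym: "\<G> \<turnstile> a \<cong> b \<^bold>: A \<Longrightarrow> \<G> \<turnstile> b \<cong> a \<^bold>: A"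
| eq_trans: "\<G> \<turnstile> a \<cong> b \<^bold>: A \<Longrightarrow> \<G> \<turnstile> b \<cong> c \<^bold>: A \<Longrightarrow> \<G> \<turnstile> a \<cong> c \<^bold>: A"
| conv: "\<G> \<turnstile> a \<^bold>: A \<Longrightarrow> \<G> \<turnstile> A \<cong> B \<^bold>: Uni i \<Longrightarrow> \<G> \<turnstile> a \<^bold>: B"
| eq_conv: "\<G> \<turnstile> a \<cong> b \<^bold>: A \<Longrightarrow> \<G> \<turnstile> A \<cong> B \<^bold>: Uni i \<Longrightarrow> \<G> \<turnstile> a \<cong> b \<^bold>: B"

| uni_intro: "\<G> ctx \<Longrightarrow> \<G> \<turnstile> Uni i \<^bold>: Uni (Suc i)"
| uni_cumul: "\<G> \<turnstile> A \<^bold>: Uni i \<Longrightarrow> \<G> \<turnstile> A \<^bold>: Uni (Suc i)"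
| uni_cumul_eq: "\<G> \<turnstile> A \<cong> B \<^bold>: Uni i \<Longrightarrow> \<G> \<turnstile> A \<cong> B \<^bold>: Uni (Suc i)"

| pi_form: "\<G> \<turnstile> A \<^bold>: Uni i \<Longrightarrow> A # \<G> \<turnstile> B \<^bold>: Uni i \<Longrightarrow> \<G> \<turnstile> Pi A B \<^bold>: Uni i"
| pi_form_eq: "\<G> \<turnstile> A \<cong> A' \<^bold>: Uni i \<Longrightarrow> A # \<G> \<turnstile> B \<cong> B' \<^bold>: Uni i \<Longrightarrow>
    \<G> \<turnstile> Pi A B \<cong> Pi A' B' \<^bold>: Uni i"
| pi_intro: "A # \<G> \<turnstile> b \<^bold>: B \<Longrightarrow> \<G> \<turnstile> Lam A b \<^bold>: Pi A B"
| pi_intro_eq: "\<G> \<turnstile> A \<cong> A' \<^bold>: Uni i \<Longrightarrow> A # \<G> \<turnstile> b \<cong> b' \<^bold>: B \<Longrightarrow>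
    \<G> \<turnstile> Lam A b \<cong> Lam A' b' \<^bold>: Pi A B"
| pi_elim: "\<G> \<turnstile> f \<^bold>: Pi A B \<Longrightarrow> \<G> \<turnstile> a \<^bold>: A \<Longrightarrow> \<G> \<turnstile> App f a \<^bold>: sub1 a B"
| pi_elim_eq: "\<G> \<turnstile> f \<cong> g \<^bold>: Pi A B \<Longrightarrow> \<G> \<turnstile> a \<cong> b \<^bold>: A \<Longrightarrow>
    \<G> \<turnstile> App f a \<cong> App g b \<^bold>: sub1 a B"
| pi_comp: "A # \<G> \<turnstile> b \<^bold>: B \<Longrightarrow> \<G> \<turnstile> a \<^bold>: A \<Longrightarrow>
    \<G> \<turnstile> App (Lam A b) a \<cong> sub1 a b \<^bold>: sub1 a B"
| pi_uniq: "\<G> \<turnstile> f \<^bold>: Pi A B \<Longrightarrow> \<G> \<turnstile> f \<cong> Lam A (App (wk 1 f) (Var 0)) \<^bold>: Pi A B"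

| sig_form: "\<G> \<turnstile> A \<^bold>: Uni i \<Longrightarrow> A # \<G> \<turnstile> B \<^bold>: Uni i \<Longrightarrow> \<G> \<turnstile> Sig A B \<^bold>: Uni i"
| sig_form_eq: "\<G> \<turnstile> A \<cong> A' \<^bold>: Uni i \<Longrightarrow> A # \<G> \<turnstile> B \<cong> B' \<^bold>: Uni i \<Longrightarrow>
    \<G> \<turnstile> Sig A B \<cong> Sig A' B' \<^bold>: Uni i"
| sig_intro: "A # \<G> \<turnstile> B \<^bold>: Uni i \<Longrightarrow> \<G> \<turnstile> a \<^bold>: A \<Longrightarrow> \<G> \<turnstile> b \<^bold>: sub1 a B \<Longrightarrow>
    \<G> \<turnstile> Pr a b \<^bold>: Sig A B"
| sig_intro_eq: "A # \<G> \<turnstile> B \<^bold>: Uni i \<Longrightarrow> \<G> \<turnstile> a \<cong> a' \<^bold>: A \<Longrightarrow> \<G> \<turnstile> b \<cong> b' \<^bold>: sub1 a B \<Longrightarrow>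
    \<G> \<turnstile> Pr a b \<cong> Pr a' b' \<^bold>: Sig A B"
| sig_elim: "Sig A B # \<G> \<turnstile> C \<^bold>: Uni i \<Longrightarrow> B # A # \<G> \<turnstile> g \<^bold>: reix 2 (Pr (Var 1) (Var 0)) C \<Longrightarrow>
    \<G> \<turnstile> p \<^bold>: Sig A B \<Longrightarrow> \<G> \<turnstile> IndSig C g p \<^bold>: sub1 p C"
| sig_elim_eq: "Sig A B # \<G> \<turnstile> C \<cong> C' \<^bold>: Uni i \<Longrightarrow>
    B # A # \<G> \<turnstile> g \<cong> g' \<^bold>: reix 2 (Pr (Var 1) (Var 0)) C \<Longrightarrow> \<G> \<turnstile> p \<cong> p' \<^bold>: Sig A B \<Longrightarrow>
    \<G> \<turnstile> IndSig C g p \<cong> IndSig C' g' p' \<^bold>: sub1 p C"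
| sig_comp: "Sig A B # \<G> \<turnstile> C \<^bold>: Uni i \<Longrightarrow> B # A # \<G> \<turnstile> g \<^bold>: reix 2 (Pr (Var 1) (Var 0)) C \<Longrightarrow>
    \<G> \<turnstile> a \<^bold>: A \<Longrightarrow> \<G> \<turnstile> b \<^bold>: sub1 a B \<Longrightarrow>
    \<G> \<turnstile> IndSig C g (Pr a b) \<cong> sub2 a b g \<^bold>: sub1 (Pr a b) C"

| plus_form: "\<G> \<turnstile> A \<^bold>: Uni i \<Longrightarrow> \<G> \<turnstile> B \<^bold>: Uni i \<Longrightarrow> \<G> \<turnstile> Plus A B \<^bold>: Uni i"
| plus_form_eq: "\<G> \<turnstile> A \<cong> A' \<^bold>: Uni i \<Longrightarrow> \<G> \<turnstile> B \<cong> B' \<^bold>: Uni i \<Longrightarrow>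
    \<G> \<turnstile> Plus A B \<cong> Plus A' B' \<^bold>: Uni i"
| plus_introL: "\<G> \<turnstile> A \<^bold>: Uni i \<Longrightarrow> \<G> \<turnstile> B \<^bold>: Uni i \<Longrightarrow> \<G> \<turnstile> a \<^bold>: A \<Longrightarrow> \<G> \<turnstile> InL a \<^bold>: Plus A B"
| plus_introL_eq: "\<G> \<turnstile> A \<^bold>: Uni i \<Longrightarrow> \<G> \<turnstile> B \<^bold>: Uni i \<Longrightarrow> \<G> \<turnstile> a \<cong> a' \<^bold>: A \<Longrightarrow>
    \<G> \<turnstile> InL a \<cong> InL a' \<^bold>: Plus A B"
| plus_introR: "\<G> \<turnstile> A \<^bold>: Uni i \<Longrightarrow> \<G> \<turnstile> B \<^bold>: Uni i \<Longrightarrow> \<G> \<turnstile> b \<^bold>: B \<Longrightarrow> \<G> \<turnstile> InR b \<^bold>: Plus A B"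
| plus_introR_eq: "\<G> \<turnstile> A \<^bold>: Uni i \<Longrightarrow> \<G> \<turnstile> B \<^bold>: Uni i \<Longrightarrow> \<G> \<turnstile> b \<cong> b' \<^bold>: B \<Longrightarrow>
    \<G> \<turnstile> InR b \<cong> InR b' \<^bold>: Plus A B"
| plus_elim: "Plus A B # \<G> \<turnstile> C \<^bold>: Uni i \<Longrightarrow>
    A # \<G> \<turnstile> c \<^bold>: reix 1 (InL (Var 0)) C \<Longrightarrow> B # \<G> \<turnstile> d \<^bold>: reix 1 (InR (Var 0)) C \<Longrightarrow>
    \<G> \<turnstile> e \<^bold>: Plus A B \<Longrightarrow> \<G> \<turnstile> IndPlus C c d e \<^bold>: sub1 e C"
| plus_elim_eq: "Plus A B # \<G> \<turnstile> C \<cong> C' \<^bold>: Uni i \<Longrightarrow>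
    A # \<G> \<turnstile> c \<cong> c' \<^bold>: reix 1 (InL (Var 0)) C \<Longrightarrow> B # \<G> \<turnstile> d \<cong> d' \<^bold>: reix 1 (InR (Var 0)) C \<Longrightarrow>
    \<G> \<turnstile> e \<cong> e' \<^bold>: Plus A B \<Longrightarrow> \<G> \<turnstile> IndPlus C c d e \<cong> IndPlus C' c' d' e' \<^bold>: sub1 e C"
| plus_compL: "Plus A B # \<G> \<turnstile> C \<^bold>: Uni i \<Longrightarrow>
    A # \<G> \<turnstile> c \<^bold>: reix 1 (InL (Var 0)) C \<Longrightarrow> B # \<G> \<turnstile> d \<^bold>: reix 1 (InR (Var 0)) C \<Longrightarrow>
    \<G> \<turnstile> a \<^bold>: A \<Longrightarrow> \<G> \<turnstile> IndPlus C c d (InL a) \<cong> sub1 a c \<^bold>: sub1 (InL a) C"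
| plus_compR: "Plus A B # \<G> \<turnstile> C \<^bold>: Uni i \<Longrightarrow>
    A # \<G> \<turnstile> c \<^bold>: reix 1 (InL (Var 0)) C \<Longrightarrow> B # \<G> \<turnstile> d \<^bold>: reix 1 (InR (Var 0)) C \<Longrightarrow>
    \<G> \<turnstile> b \<^bold>: B \<Longrightarrow> \<G> \<turnstile> IndPlus C c d (InR b) \<cong> sub1 b d \<^bold>: sub1 (InR b) C"

| empty_form: "\<G> ctx \<Longrightarrow> \<G> \<turnstile> Empty \<^bold>: Uni i"
| empty_elim: "Empty # \<G> \<turnstile> C \<^bold>: Uni i \<Longrightarrow> \<G> \<turnstile> a \<^bold>: Empty \<Longrightarrow> \<G> \<turnstile> IndEmpty C a \<^bold>: sub1 a C"
| empty_elim_eq: "Empty # \<G> \<turnstile> C \<cong> C' \<^bold>: Uni i \<Longrightarrow> \<G> \<turnstile> a \<cong> a' \<^bold>: Empty \<Longrightarrow>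
    \<G> \<turnstile> IndEmpty C a \<cong> IndEmpty C' a' \<^bold>: sub1 a C"

| one_form: "\<G> ctx \<Longrightarrow> \<G> \<turnstile> One \<^bold>: Uni i"
| one_intro: "\<G> ctx \<Longrightarrow> \<G> \<turnstile> Star \<^bold>: One"
| one_elim: "One # \<G> \<turnstile> C \<^bold>: Uni i \<Longrightarrow> \<G> \<turnstile> c \<^bold>: sub1 Star C \<Longrightarrow> \<G> \<turnstile> a \<^bold>: One \<Longrightarrow>
    \<G> \<turnstile> IndOne C c a \<^bold>: sub1 a C"
| one_elim_eq: "One # \<G> \<turnstile> C \<cong> C' \<^bold>: Uni i \<Longrightarrow> \<G> \<turnstile> c \<cong> c' \<^bold>: sub1 Star C \<Longrightarrow>
    \<G> \<turnstile> a \<cong> a' \<^bold>: One \<Longrightarrow> \<G> \<turnstile> IndOne C c a \<cong> IndOne C' c' a' \<^bold>: sub1 a C"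
| one_comp: "One # \<G> \<turnstile> C \<^bold>: Uni i \<Longrightarrow> \<G> \<turnstile> c \<^bold>: sub1 Star C \<Longrightarrow>
    \<G> \<turnstile> IndOne C c Star \<cong> c \<^bold>: sub1 Star C"

| nat_form: "\<G> ctx \<Longrightarrow> \<G> \<turnstile> Nat \<^bold>: Uni i"
| nat_zero: "\<G> ctx \<Longrightarrow> \<G> \<turnstile> Zero \<^bold>: Nat"
| nat_succ: "\<G> \<turnstile> n \<^bold>: Nat \<Longrightarrow> \<G> \<turnstile> Succ n \<^bold>: Nat"
| nat_succ_eq: "\<G> \<turnstile> n \<cong> n' \<^bold>: Nat \<Longrightarrow> \<G> \<turnstile> Succ n \<cong> Succ n' \<^bold>: Nat"
| nat_elim: "Nat # \<G> \<turnstile> C \<^bold>: Uni i \<Longrightarrow> \<G> \<turnstile> c \<^bold>: sub1 Zero C \<Longrightarrow>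
    C # Nat # \<G> \<turnstile> d \<^bold>: reix 2 (Succ (Var 1)) C \<Longrightarrow> \<G> \<turnstile> n \<^bold>: Nat \<Longrightarrow>
    \<G> \<turnstile> IndNat C c d n \<^bold>: sub1 n C"
| nat_elim_eq: "Nat # \<G> \<turnstile> C \<cong> C' \<^bold>: Uni i \<Longrightarrow> \<G> \<turnstile> c \<cong> c' \<^bold>: sub1 Zero C \<Longrightarrow>
    C # Nat # \<G> \<turnstile> d \<cong> d' \<^bold>: reix 2 (Succ (Var 1)) C \<Longrightarrow> \<G> \<turnstile> n \<cong> n' \<^bold>: Nat \<Longrightarrow>
    \<G> \<turnstile> IndNat C c d n \<cong> IndNat C' c' d' n' \<^bold>: sub1 n C"
| nat_comp_zero: "Nat # \<G> \<turnstile> C \<^bold>: Uni i \<Longrightarrow> \<G> \<turnstile> c \<^bold>: sub1 Zero C \<Longrightarrow>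
    C # Nat # \<G> \<turnstile> d \<^bold>: reix 2 (Succ (Var 1)) C \<Longrightarrow>
    \<G> \<turnstile> IndNat C c d Zero \<cong> c \<^bold>: sub1 Zero C"
| nat_comp_succ: "Nat # \<G> \<turnstile> C \<^bold>: Uni i \<Longrightarrow> \<G> \<turnstile> c \<^bold>: sub1 Zero C \<Longrightarrow>
    C # Nat # \<G> \<turnstile> d \<^bold>: reix 2 (Succ (Var 1)) C \<Longrightarrow> \<G> \<turnstile> n \<^bold>: Nat \<Longrightarrow>
    \<G> \<turnstile> IndNat C c d (Succ n) \<cong> sub2 n (IndNat C c d n) d \<^bold>: sub1 (Succ n) C"

| id_form: "\<G> \<turnstile> A \<^bold>: Uni i \<Longrightarrow> \<G> \<turnstile> a \<^bold>: A \<Longrightarrow> \<G> \<turnstile> b \<^bold>: A \<Longrightarrow> \<G> \<turnstile> Id A a b \<^bold>: Uni i"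
| id_form_eq: "\<G> \<turnstile> A \<cong> A' \<^bold>: Uni i \<Longrightarrow> \<G> \<turnstile> a \<cong> a' \<^bold>: A \<Longrightarrow> \<G> \<turnstile> b \<cong> b' \<^bold>: A \<Longrightarrow>
    \<G> \<turnstile> Id A a b \<cong> Id A' a' b' \<^bold>: Uni i"
| id_intro: "\<G> \<turnstile> A \<^bold>: Uni i \<Longrightarrow> \<G> \<turnstile> a \<^bold>: A \<Longrightarrow> \<G> \<turnstile> Refl a \<^bold>: Id A a a"
| id_intro_eq: "\<G> \<turnstile> A \<^bold>: Uni i \<Longrightarrow> \<G> \<turnstile> a \<cong> a' \<^bold>: A \<Longrightarrow> \<G> \<turnstile> Refl a \<cong> Refl a' \<^bold>: Id A a a"
| id_elim: "Id (wk 2 A) (Var 1) (Var 0) # wk 1 A # A # \<G> \<turnstile> C \<^bold>: Uni i \<Longrightarrow>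
    A # \<G> \<turnstile> c \<^bold>: subst (Refl (Var 0) \<bullet> Var 0 \<bullet> Var) C \<Longrightarrow>
    \<G> \<turnstile> a \<^bold>: A \<Longrightarrow> \<G> \<turnstile> b \<^bold>: A \<Longrightarrow> \<G> \<turnstile> p \<^bold>: Id A a b \<Longrightarrow>
    \<G> \<turnstile> IndId C c a b p \<^bold>: sub3 a b p C"
| id_elim_eq: "Id (wk 2 A) (Var 1) (Var 0) # wk 1 A # A # \<G> \<turnstile> C \<cong> C' \<^bold>: Uni i \<Longrightarrow>
    A # \<G> \<turnstile> c \<cong> c' \<^bold>: subst (Refl (Var 0) \<bullet> Var 0 \<bullet> Var) C \<Longrightarrow>
    \<G> \<turnstile> a \<cong> a' \<^bold>: A \<Longrightarrow> \<G> \<turnstile> b \<cong> b' \<^bold>: A \<Longrightarrow> \<G> \<turnstile> p \<cong> p' \<^bold>: Id A a b \<Longrightarrow>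
    \<G> \<turnstile> IndId C c a b p \<cong> IndId C' c' a' b' p' \<^bold>: sub3 a b p C"
| id_comp: "Id (wk 2 A) (Var 1) (Var 0) # wk 1 A # A # \<G> \<turnstile> C \<^bold>: Uni i \<Longrightarrow>
    A # \<G> \<turnstile> c \<^bold>: subst (Refl (Var 0) \<bullet> Var 0 \<bullet> Var) C \<Longrightarrow> \<G> \<turnstile> a \<^bold>: A \<Longrightarrow>
    \<G> \<turnstile> IndId C c a a (Refl a) \<cong> sub1 a c \<^bold>: sub3 a a (Refl a) C"

| funext: "\<G> \<turnstile> f \<^bold>: Pi A B \<Longrightarrow> \<G> \<turnstile> g \<^bold>: Pi A B \<Longrightarrow>
    \<G> \<turnstile> Funext f g \<^bold>: isEquiv (Id (Pi A B) f g) (Htpy A B f g) (happly A B f g)"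
| funext_eq: "\<G> \<turnstile> f \<cong> f' \<^bold>: Pi A B \<Longrightarrow> \<G> \<turnstile> g \<cong> g' \<^bold>: Pi A B \<Longrightarrow>
    \<G> \<turnstile> Funext f g \<cong> Funext f' g' \<^bold>:
      isEquiv (Id (Pi A B) f g) (Htpy A B f g) (happly A B f g)"

| univalence: "\<G> \<turnstile> A \<^bold>: Uni i \<Longrightarrow> \<G> \<turnstile> B \<^bold>: Uni i \<Longrightarrow>
    \<G> \<turnstile> Univalence i A B \<^bold>: isEquiv (Id (Uni i) A B) (Equiv A B) (idtoeqv i A B)"
| univalence_eq: "\<G> \<turnstile> A \<cong> A' \<^bold>: Uni i \<Longrightarrow> \<G> \<turnstile> B \<cong> B' \<^bold>: Uni i \<Longrightarrow>
    \<G> \<turnstile> Univalence i A B \<cong> Univalence i A' B' \<^bold>: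
      isEquiv (Id (Uni i) A B) (Equiv A B) (idtoeqv i A B)"

| circle_form: "\<G> ctx \<Longrightarrow> \<G> \<turnstile> Circle \<^bold>: Uni i"
| circle_base: "\<G> ctx \<Longrightarrow> \<G> \<turnstile> Base \<^bold>: Circle"
| circle_loop: "\<G> ctx \<Longrightarrow> \<G> \<turnstile> Loop \<^bold>: Id Circle Base Base"
| circle_elim: "Circle # \<G> \<turnstile> C \<^bold>: Uni i \<Longrightarrow> \<G> \<turnstile> b \<^bold>: sub1 Base C \<Longrightarrow>
    \<G> \<turnstile> l \<^bold>: Id (sub1 Base C) (App (transp C Base Base Loop) b) b \<Longrightarrow>
    \<G> \<turnstile> p \<^bold>: Circle \<Longrightarrow> \<G> \<turnstile> IndCircle C b l p \<^bold>: sub1 p C"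
| circle_elim_eq: "Circle # \<G> \<turnstile> C \<cong> C' \<^bold>: Uni i \<Longrightarrow> \<G> \<turnstile> b \<cong> b' \<^bold>: sub1 Base C \<Longrightarrow>
    \<G> \<turnstile> l \<cong> l' \<^bold>: Id (sub1 Base C) (App (transp C Base Base Loop) b) b \<Longrightarrow>
    \<G> \<turnstile> p \<cong> p' \<^bold>: Circle \<Longrightarrow> \<G> \<turnstile> IndCircle C b l p \<cong> IndCircle C' b' l' p' \<^bold>: sub1 p C"
| circle_comp: "Circle # \<G> \<turnstile> C \<^bold>: Uni i \<Longrightarrow> \<G> \<turnstile> b \<^bold>: sub1 Base C \<Longrightarrow>
    \<G> \<turnstile> l \<^bold>: Id (sub1 Base C) (App (transp C Base Base Loop) b) b \<Longrightarrow>
    \<G> \<turnstile> IndCircle C b l Base \<cong> b \<^bold>: sub1 Base C"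
| circle_loopcomp: "Circle # \<G> \<turnstile> C \<^bold>: Uni i \<Longrightarrow> \<G> \<turnstile> b \<^bold>: sub1 Base C \<Longrightarrow>
    \<G> \<turnstile> l \<^bold>: Id (sub1 Base C) (App (transp C Base Base Loop) b) b \<Longrightarrow>
    \<G> \<turnstile> LoopComp C b l \<^bold>:
      Id (Id (sub1 Base C) (App (transp C Base Base Loop) b) b)
         (apd C (Lam Circle (IndCircle (wkf 1 C) (wk 1 b) (wk 1 l) (Var 0))) Base Base Loop) l"
| circle_loopcomp_eq: "Circle # \<G> \<turnstile> C \<cong> C' \<^bold>: Uni i \<Longrightarrow> \<G> \<turnstile> b \<cong> b' \<^bold>: sub1 Base C \<Longrightarrow>
    \<G> \<turnstile> l \<cong> l' \<^bold>: Id (sub1 Base C) (App (transp C Base Base Loop) b) b \<Longrightarrow>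
    \<G> \<turnstile> LoopComp C b l \<cong> LoopComp C' b' l' \<^bold>:
      Id (Id (sub1 Base C) (App (transp C Base Base Loop) b) b)
         (apd C (Lam Circle (IndCircle (wkf 1 C) (wk 1 b) (wk 1 l) (Var 0))) Base Base Loop) l"

subsection \<open>0-concrete categories\<close>

text \<open>
  \<open>\<Sigma> obj : Type. \<Sigma> real : obj \<rightarrow> Type. \<Sigma> hom : obj \<rightarrow> obj \<rightarrow> Type.
    \<Pi> x y : obj. hom x y \<simeq> (real x \<rightarrow> real y)\<close>, where \<open>Type\<close> is the universe \<open>Uni i\<close> and
  \<open>real\<close> is the object realisation map.
\<close>

definition ConcCat0 :: "nat \<Rightarrow> tm"
  where "ConcCat0 i =
    Sig (Uni i)
      (Sig (Arr (Var 0) (Uni i))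
        (Sig (Arr (Var 1) (Arr (Var 1) (Uni i)))
          (Pi (Var 2) (Pi (Var 3)
            (Equiv (App (App (Var 2) (Var 1)) (Var 0))
                   (Arr (App (Var 3) (Var 1)) (App (Var 3) (Var 0))))))))"

text \<open>
  \<open>obj\<close> is the two-element type, with elements \<open>x\<close>, \<open>y\<close> (the images of the two canonical elements
  of \<open>Two\<close> under an equivalence), and \<open>hom\<close> is that of two copies of the terminal category.
\<close>

definition TwoPointsOn :: "tm \<Rightarrow> tm \<Rightarrow> tm"
  where "TwoPointsOn obj hom =
    Sig (Arr Two obj)
      (let x = App (Var 0) (InL Star);
           y = App (Var 0) (InR Star);
           H = (\<lambda>a b. App (App (wk 1 hom) a) b)
       in Prod (isEquiv Two (wk 1 obj) (Var 0))
         (Prod (isContr (H x x)) (Prod (isContr (H y y))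
           (Prod (Neg (H x y)) (Neg (H y x))))))"

text \<open>
  The same for the components of a 0-concrete category \<open>K\<close>, obtained by \<open>\<Sigma>\<close>-induction with
  constant motive.  Each elimination binds a component and a remainder, so that the innermost
  context is \<open>conf\<close> (0), \<open>hom\<close> (1), remainder, \<open>real\<close> (3), remainder, \<open>obj\<close> (5).
\<close>

definition IsTwoPoints :: "nat \<Rightarrow> tm \<Rightarrow> tm"
  where "IsTwoPoints i K =
    IndSig (Uni i)
      (IndSig (Uni i)
        (IndSig (Uni i) (TwoPointsOn (Var 5) (Var 1)) (Var 0))
        (Var 0))
      K"

end

theory Submission
  imports Defs
begin

text \<open>
  Write \<open>X\<close>, \<open>Y\<close> for the realisations of the two objects.  An element \<open>b\<close> of \<open>Y\<close> gives the constant
  map \<open>X \<rightarrow> Y\<close>, hence a morphism from \<open>x\<close> to \<open>y\<close>, which is absurd; so there is a map \<open>Y \<rightarrow> X\<close> by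
  elimination of the empty type, hence a morphism from \<open>y\<close> to \<open>x\<close>, which is absurd as well.
\<close>

subsection \<open>Renaming and substitution\<close>

text \<open>The argument has to be intuitionistic, so it never asks whether \<open>Y\<close> is
  inhabited: the contradiction found under an assumed element of \<open>Y\<close> is kept as an open
  term and becomes the body of the map back. Two features of the deep embedding shape the rest.
  Every abstraction and every eliminator moves terms into a longer context, while weakening is not
  among the rules; hence judgements quantified over all renamings. And the statement about a
  category \<open>K\<close> is a type computed by elimination on \<open>K\<close>, which reduces
  only on pairs, whereas the category at hand is a variable; hence one elimination per layer, with a
  motive that contains the statement to be refuted. Later steps use only that the terms exist, so
  the lemmas that produce inverses and contradictions end in an existential quantifier.\<close>

lemma upr_simps [simp]: "upr r 0 = 0" "upr r (Suc n) = Suc (r n)"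
  by (simp_all add: upr_def)

text \<open>Shifts appear as \<open>ren Suc\<close> instead of \<open>wk 1\<close>, so that the
  fusion laws below apply to them.\<close>

lemma up_simps [simp]: "up s 0 = Var 0" "up s (Suc n) = ren Suc (s n)"
  by (simp_all add: up_def wk_def)

lemma upr_upr: "(\<lambda>n. upr r (upr q n)) = upr (\<lambda>n. r (q n))"
  by (rule ext, case_tac n) simp_all

text \<open>Together with \<open>subst_ren\<close>, \<open>ren_subst\<close> and
  \<open>subst_Var_ren\<close> this fuses such composite traversals into one, so that an identity
  between terms becomes one between functions on indices.\<close>

lemma ren_ren [simp]: "ren r (ren q t) = ren (\<lambda>n. r (q n)) t"
  by (induction t arbitrary: r q) (simp_all add: upr_upr)

lemma up_upr: "(\<lambda>n. up s (upr r n)) = up (\<lambda>n. s (r n))"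
  by (rule ext, case_tac n) simp_all

lemma subst_ren [simp]: "subst s (ren r t) = subst (\<lambda>n. s (r n)) t"
  by (induction t arbitrary: s r) (simp_all add: up_upr)

lemma ren_up: "(\<lambda>n. ren (upr r) (up s n)) = up (\<lambda>n. ren r (s n))"
  by (rule ext, case_tac n) simp_all

lemma ren_subst [simp]: "ren r (subst s t) = subst (\<lambda>n. ren r (s n)) t"
  by (induction t arbitrary: s r) (simp_all add: ren_up)

lemma up_Var: "up (\<lambda>n. Var (r n)) = (\<lambda>n. Var (upr r n))"
  by (rule ext, case_tac n) simp_all

lemma subst_Var_ren [simp]: "subst (\<lambda>n. Var (r n)) t = ren r t"
  by (induction t arbitrary: r) (simp_all add: up_Var)

lemma upr_id: "upr (\<lambda>n. n) = (\<lambda>n. n)"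
  by (rule ext, case_tac n) simp_all

lemma ren_id [simp]: "ren (\<lambda>n. n) t = t"
  by (induction t) (simp_all add: upr_id)

lemma subst_Var [simp]: "subst Var t = t"
  using subst_Var_ren[of "\<lambda>n. n" t] by simp

text \<open>Kept out of the simpset, where \<open>ren_subst\<close> already fuses the left side. It
  restores the shape in which the typing rules state their conclusions, after a renaming has been
  pushed inside; \<open>ren_sub2\<close> and \<open>ren_reix_pair\<close> do the same for the rules
  of Sigma-types.\<close>

lemma ren_sub1: "ren r (sub1 a B) = sub1 (ren r a) (ren (upr r) B)"
proof -
  have "(\<lambda>n. ren r ((a \<bullet> Var) n)) = (\<lambda>n. (ren r a \<bullet> Var) (upr r n))"
    by (rule ext, case_tac n) simp_all
  then show ?thesis by simp
qed

lemma ren_sub2: "ren r (sub2 a b B) = sub2 (ren r a) (ren r b) (ren (upr (upr r)) B)"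
proof -
  have "(\<lambda>n. ren r ((b \<bullet> a \<bullet> Var) n)) = (\<lambda>n. (ren r b \<bullet> ren r a \<bullet> Var) (upr (upr r) n))"
    by (rule ext, case_tac n, simp, case_tac nat) simp_all
  then show ?thesis by simp
qed

lemma ren_reix_pair: "ren (upr (upr r)) (reix 2 (Pr (Var 1) (Var 0)) C) =
  reix 2 (Pr (Var 1) (Var 0)) (ren (upr r) C)"
proof -
  have "(\<lambda>n. ren (upr (upr r)) ((Pr (Var 1) (Var 0) \<bullet> (\<lambda>n. Var (n + 2))) n)) =
    (\<lambda>n. (Pr (Var 1) (Var 0) \<bullet> (\<lambda>n. Var (n + 2))) (upr r n))"
    by (rule ext, case_tac n) simp_all
  then show ?thesis unfolding reix_def ren_subst subst_ren by (rule arg_cong)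
qed

lemma ren_derived [simp]:
  "ren r (Arr A B) = Arr (ren r A) (ren r B)"
  "ren r (Prod A B) = Prod (ren r A) (ren r B)"
  "ren r (Neg A) = Neg (ren r A)"
  "ren r Two = Two"
  "ren r (isContr A) = isContr (ren r A)"
  "ren r (isEquiv A B f) = isEquiv (ren r A) (ren r B) (ren r f)"
  "ren r (Equiv A B) = Equiv (ren r A) (ren r B)"
  "ren r (TwoPointsOn A f) = TwoPointsOn (ren r A) (ren r f)"
  by (simp_all add: Arr_def Prod_def Neg_def Two_def isContr_def isEquiv_def Equiv_def
      TwoPointsOn_def Let_def wk_def)

lemma subst_derived [simp]:
  "subst s (Arr A B) = Arr (subst s A) (subst s B)"
  "subst s (Prod A B) = Prod (subst s A) (subst s B)"
  "subst s (Neg A) = Neg (subst s A)"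
  "subst s Two = Two"
  "subst s (isContr A) = isContr (subst s A)"
  "subst s (isEquiv A B f) = isEquiv (subst s A) (subst s B) (subst s f)"
  "subst s (Equiv A B) = Equiv (subst s A) (subst s B)"
  "subst s (TwoPointsOn A f) = TwoPointsOn (subst s A) (subst s f)"
  by (simp_all add: Arr_def Prod_def Neg_def Two_def isContr_def isEquiv_def Equiv_def
      TwoPointsOn_def Let_def wk_def)

subsection \<open>Stable judgements\<close>

text \<open>Well-formedness is demanded of the target context alone. The rules for stable judgements
  therefore need no premise that \<open>\<G>\<close> is a context.\<close>

definition renaming :: "(nat \<Rightarrow> nat) \<Rightarrow> cxt \<Rightarrow> cxt \<Rightarrow> bool"
  where "renaming r \<G> \<D> \<longleftrightarrow> \<D> ctx \<and>
    (\<forall>n<length \<G>. r n < length \<D> \<and> wk (Suc (r n)) (\<D> ! r n) = ren r (wk (Suc n) (\<G> ! n)))"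

text \<open>
  Derivability in every renaming of the context.  Weakening is then immediate, so that its
  admissibility need not be proved by induction over all the rules of the theory.
\<close>

definition stable :: "cxt \<Rightarrow> tm \<Rightarrow> tm \<Rightarrow> bool"  ("_ \<Turnstile> _ \<^bold>: _" [51, 51, 51] 50)
  where "\<G> \<Turnstile> a \<^bold>: A \<longleftrightarrow> (\<forall>r \<D>. renaming r \<G> \<D> \<longrightarrow> \<D> \<turnstile> ren r a \<^bold>: ren r A)"

definition stable_eq :: "cxt \<Rightarrow> tm \<Rightarrow> tm \<Rightarrow> tm \<Rightarrow> bool"  ("_ \<Turnstile> _ \<cong> _ \<^bold>: _" [51, 51, 51, 51] 50)
  where "\<G> \<Turnstile> a \<cong> b \<^bold>: A \<longleftrightarrow> (\<forall>r \<D>. renaming r \<G> \<D> \<longrightarrow> \<D> \<turnstile> ren r a \<cong> ren r b \<^bold>: ren r A)"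

lemma stableI: "(\<And>r \<D>. renaming r \<G> \<D> \<Longrightarrow> \<D> \<turnstile> ren r a \<^bold>: ren r A) \<Longrightarrow> \<G> \<Turnstile> a \<^bold>: A"
  by (simp add: stable_def)

lemma stableD: "\<G> \<Turnstile> a \<^bold>: A \<Longrightarrow> renaming r \<G> \<D> \<Longrightarrow> \<D> \<turnstile> ren r a \<^bold>: ren r A"
  by (simp add: stable_def)

lemma renaming_ctx: "renaming r \<G> \<D> \<Longrightarrow> \<D> ctx"
  by (simp add: renaming_def)

text \<open>The way back to derivability: the identity is a renaming of the empty context into
  itself, since that context is well-formed by \<open>ctx_emp\<close>.\<close>

lemma stable_imp_typing: "[] \<Turnstile> a \<^bold>: A \<Longrightarrow> [] \<turnstile> a \<^bold>: A"
  using stableD[of "[]" a A "\<lambda>n. n" "[]"] by (simp add: renaming_def ctx_emp)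

text \<open>Stability of \<open>A\<close> makes the extended target a context. This is why rules
  with binders, such as \<open>stable_pi_intro\<close>, carry formation premises that the original
  rules lack.\<close>

lemma renaming_up:
  assumes "renaming r \<G> \<D>" "\<G> \<Turnstile> A \<^bold>: Uni i"
  shows "renaming (upr r) (A # \<G>) (ren r A # \<D>)"
proof -
  have "(ren r A # \<D>) ctx"
    using stableD[OF assms(2,1)] by (auto intro: ctx_ext)
  moreover have "ren (\<lambda>k. Suc (k + Suc (r n))) (\<D> ! r n) = ren (\<lambda>k. Suc (r (k + Suc n))) (\<G> ! n)"
    if "n < length \<G>" for n
  proof -
    have "ren Suc (wk (Suc (r n)) (\<D> ! r n)) = ren Suc (ren r (wk (Suc n) (\<G> ! n)))"
      using assms(1) that by (simp add: renaming_def)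
    then show ?thesis by (simp add: wk_def)
  qed
  ultimately show ?thesis
    using assms(1) by (auto simp: renaming_def wk_def nth_Cons split: nat.split)
qed

lemma stable_wk:
  assumes "\<G> \<Turnstile> a \<^bold>: A"
  shows "B # \<G> \<Turnstile> wk 1 a \<^bold>: wk 1 A"
proof (rule stableI)
  fix r \<D> assume r: "renaming r (B # \<G>) \<D>"
  \<comment> \<open>Skipping the newest variable turns a renaming of the extended context into one
    of \<open>\<G>\<close>, so weakening is precomposition with the shift.\<close>
  have "renaming (\<lambda>n. r (Suc n)) \<G> \<D>"
    unfolding renaming_def
  proof (intro conjI allI impI)
    fix n assume "n < length \<G>"
    then have "Suc n < length (B # \<G>)" by simp
    with r have *: "r (Suc n) < length \<D>"
      "wk (Suc (r (Suc n))) (\<D> ! r (Suc n)) = ren r (wk (Suc (Suc n)) ((B # \<G>) ! Suc n))"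
      unfolding renaming_def by blast+
    show "r (Suc n) < length \<D>" by fact
    show "wk (Suc (r (Suc n))) (\<D> ! r (Suc n)) = ren (\<lambda>n. r (Suc n)) (wk (Suc n) (\<G> ! n))"
      using *(2) by (simp add: wk_def)
  qed (rule renaming_ctx[OF r])
  from stableD[OF assms this] show "\<D> \<turnstile> ren r (wk 1 a) \<^bold>: ren r (wk 1 A)"
    by (simp add: wk_def)
qed

text \<open>The equations accept terms and types that agree with a weakening only after fusion. The
  parameters \<open>T\<close> in \<open>stable_var\<close>, \<open>stable_pi_elim\<close> and the
  Sigma rules serve the same purpose.\<close>

lemma stable_wk': "\<G> \<Turnstile> a \<^bold>: A \<Longrightarrow> b = wk 1 a \<Longrightarrow> T = wk 1 A \<Longrightarrow> B # \<G> \<Turnstile> b \<^bold>: T"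
  using stable_wk by blast

lemma stable_wk2: "\<G> \<Turnstile> a \<^bold>: A \<Longrightarrow> C # B # \<G> \<Turnstile> wk 2 a \<^bold>: wk 2 A"
  using stable_wk[OF stable_wk[of \<G> a A B], of C] by (simp add: wk_def)

lemma stable_wk3: "\<G> \<Turnstile> a \<^bold>: A \<Longrightarrow> D # C # B # \<G> \<Turnstile> wk 3 a \<^bold>: wk 3 A"
  using stable_wk[OF stable_wk2[of \<G> a A C B], of D] by (simp add: wk_def numeral_3_eq_3)

section \<open>Typing rules for stable judgements\<close>

lemma stable_var: "n < length \<G> \<Longrightarrow> T = wk (Suc n) (\<G> ! n) \<Longrightarrow> \<G> \<Turnstile> Var n \<^bold>: T"
  unfolding stable_def renaming_def by (metis ren.simps(1) var)

lemma stable_uni: "\<G> \<Turnstile> Uni i \<^bold>: Uni (Suc i)"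
  by (rule stableI) (auto intro: uni_intro renaming_ctx)

lemma stable_cumul: "\<G> \<Turnstile> A \<^bold>: Uni i \<Longrightarrow> \<G> \<Turnstile> A \<^bold>: Uni (Suc i)"
  unfolding stable_def by (auto intro: uni_cumul)

lemma stable_pi_form:
  assumes "\<G> \<Turnstile> A \<^bold>: Uni i" "A # \<G> \<Turnstile> B \<^bold>: Uni i"
  shows "\<G> \<Turnstile> Pi A B \<^bold>: Uni i"
  using stableD[OF assms(1)] stableD[OF assms(2) renaming_up[OF _ assms(1)]]
  by (auto intro!: stableI pi_form)

lemma stable_pi_intro:
  assumes "\<G> \<Turnstile> A \<^bold>: Uni i" "A # \<G> \<Turnstile> b \<^bold>: B"
  shows "\<G> \<Turnstile> Lam A b \<^bold>: Pi A B"
  using stableD[OF assms(2) renaming_up[OF _ assms(1)]]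
  by (auto intro!: stableI pi_intro)

lemma stable_pi_elim:
  assumes "\<G> \<Turnstile> f \<^bold>: Pi A B" "\<G> \<Turnstile> a \<^bold>: A" "T = sub1 a B"
  shows "\<G> \<Turnstile> App f a \<^bold>: T"
proof (rule stableI)
  fix r \<D> assume r: "renaming r \<G> \<D>"
  show "\<D> \<turnstile> ren r (App f a) \<^bold>: ren r T"
    unfolding assms(3) ren.simps ren_sub1
    by (rule pi_elim[OF stableD[OF assms(1) r, unfolded ren.simps] stableD[OF assms(2) r]])
qed

lemma stable_sig_form:
  assumes "\<G> \<Turnstile> A \<^bold>: Uni i" "A # \<G> \<Turnstile> B \<^bold>: Uni i"
  shows "\<G> \<Turnstile> Sig A B \<^bold>: Uni i"
  using stableD[OF assms(1)] stableD[OF assms(2) renaming_up[OF _ assms(1)]]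
  by (auto intro!: stableI sig_form)

lemma stable_sig_intro:
  assumes "\<G> \<Turnstile> A \<^bold>: Uni i" "A # \<G> \<Turnstile> B \<^bold>: Uni i" "\<G> \<Turnstile> a \<^bold>: A" "\<G> \<Turnstile> b \<^bold>: sub1 a B"
  shows "\<G> \<Turnstile> Pr a b \<^bold>: Sig A B"
proof (rule stableI)
  fix r \<D> assume r: "renaming r \<G> \<D>"
  show "\<D> \<turnstile> ren r (Pr a b) \<^bold>: ren r (Sig A B)"
    unfolding ren.simps
    by (rule sig_intro[OF stableD[OF assms(2) renaming_up[OF r assms(1)], unfolded ren.simps]
          stableD[OF assms(3) r] stableD[OF assms(4) r, unfolded ren_sub1]])
qed

text \<open>The formation premises on \<open>A\<close> and \<open>B\<close> carry renamings under
  the binders of \<open>C\<close> and \<open>g\<close>. The universe of the motive is independent of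
  theirs: the components of a category live one universe above the types that are eliminated into
  later.\<close>

lemma stable_sig_elim:
  assumes A: "\<G> \<Turnstile> A \<^bold>: Uni i" and B: "A # \<G> \<Turnstile> B \<^bold>: Uni i"
    and C: "Sig A B # \<G> \<Turnstile> C \<^bold>: Uni j"
    and g: "B # A # \<G> \<Turnstile> g \<^bold>: reix 2 (Pr (Var 1) (Var 0)) C"
    and p: "\<G> \<Turnstile> p \<^bold>: Sig A B" and T: "T = sub1 p C"
  shows "\<G> \<Turnstile> IndSig C g p \<^bold>: T"
proof (rule stableI)
  fix r \<D> assume r: "renaming r \<G> \<D>"
  note rA = renaming_up[OF r A]
  show "\<D> \<turnstile> ren r (IndSig C g p) \<^bold>: ren r T"
    unfolding T ren.simps ren_sub1
    by (rule sig_elim[OF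
          stableD[OF C renaming_up[OF r stable_sig_form[OF A B]], unfolded ren.simps]
          stableD[OF g renaming_up[OF rA B], unfolded ren_reix_pair]
          stableD[OF p r, unfolded ren.simps]])
qed

text \<open>The one computation rule of the whole argument; it unfolds the type-valued eliminations
  inside \<open>IsTwoPoints\<close> once their argument is a pair.\<close>

lemma stable_sig_comp:
  assumes A: "\<G> \<Turnstile> A \<^bold>: Uni i" and B: "A # \<G> \<Turnstile> B \<^bold>: Uni i"
    and C: "Sig A B # \<G> \<Turnstile> C \<^bold>: Uni j"
    and g: "B # A # \<G> \<Turnstile> g \<^bold>: reix 2 (Pr (Var 1) (Var 0)) C"
    and a: "\<G> \<Turnstile> a \<^bold>: A" and b: "\<G> \<Turnstile> b \<^bold>: sub1 a B"
    and h: "h = sub2 a b g" and T: "T = sub1 (Pr a b) C"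
  shows "\<G> \<Turnstile> IndSig C g (Pr a b) \<cong> h \<^bold>: T"
  unfolding stable_eq_def
proof (intro allI impI)
  fix r \<D> assume r: "renaming r \<G> \<D>"
  note rA = renaming_up[OF r A]
  show "\<D> \<turnstile> ren r (IndSig C g (Pr a b)) \<cong> ren r h \<^bold>: ren r T"
    unfolding T h ren.simps ren_sub1 ren_sub2
    by (rule sig_comp[OF
          stableD[OF C renaming_up[OF r stable_sig_form[OF A B]], unfolded ren.simps]
          stableD[OF g renaming_up[OF rA B], unfolded ren_reix_pair]
          stableD[OF a r] stableD[OF b r, unfolded ren_sub1]])
qed

lemma stable_conv: "\<G> \<Turnstile> a \<^bold>: A \<Longrightarrow> \<G> \<Turnstile> A \<cong> B \<^bold>: Uni i \<Longrightarrow> \<G> \<Turnstile> a \<^bold>: B"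
  unfolding stable_def stable_eq_def by (metis conv ren.simps(2))

lemma stable_two_form: "\<G> \<Turnstile> Two \<^bold>: Uni i"
  by (rule stableI) (auto simp: Two_def intro: plus_form one_form renaming_ctx)

lemma stable_two_intro: "\<G> \<Turnstile> InL Star \<^bold>: Two" "\<G> \<Turnstile> InR Star \<^bold>: Two"
  by (rule stableI, auto simp: Two_def intro!: plus_introL[of _ One 0] plus_introR[of _ One 0]
      one_form one_intro renaming_ctx)+

lemma stable_empty_form: "\<G> \<Turnstile> Empty \<^bold>: Uni i"
  by (rule stableI) (auto intro: empty_form renaming_ctx)

lemma stable_empty_elim:
  assumes "\<G> \<Turnstile> C \<^bold>: Uni i" "\<G> \<Turnstile> a \<^bold>: Empty"
  shows "\<G> \<Turnstile> IndEmpty (wk 1 C) a \<^bold>: C"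
proof (rule stableI)
  fix r \<D> assume r: "renaming r \<G> \<D>"
  have "Empty # \<D> \<turnstile> ren (upr r) (wk 1 C) \<^bold>: Uni i"
    using stableD[OF stable_wk[OF assms(1)] renaming_up[OF r stable_empty_form]] by (simp add: wk_def)
  from empty_elim[OF this] stableD[OF assms(2) r]
  show "\<D> \<turnstile> ren r (IndEmpty (wk 1 C) a) \<^bold>: ren r C"
    by (simp add: wk_def)
qed

lemma stable_id_form:
  "\<G> \<Turnstile> A \<^bold>: Uni i \<Longrightarrow> \<G> \<Turnstile> a \<^bold>: A \<Longrightarrow> \<G> \<Turnstile> b \<^bold>: A \<Longrightarrow> \<G> \<Turnstile> Id A a b \<^bold>: Uni i"
  unfolding stable_def by (auto intro: id_form)

subsection \<open>Derived type formers\<close>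

lemma stable_arr_form: "\<G> \<Turnstile> A \<^bold>: Uni i \<Longrightarrow> \<G> \<Turnstile> B \<^bold>: Uni i \<Longrightarrow> \<G> \<Turnstile> Arr A B \<^bold>: Uni i"
  unfolding Arr_def by (rule stable_pi_form) (auto intro: stable_wk' simp: wk_def)

lemma stable_arr_intro: "\<G> \<Turnstile> A \<^bold>: Uni i \<Longrightarrow> A # \<G> \<Turnstile> b \<^bold>: wk 1 B \<Longrightarrow> \<G> \<Turnstile> Lam A b \<^bold>: Arr A B"
  unfolding Arr_def by (rule stable_pi_intro)

lemma stable_arr_elim: "\<G> \<Turnstile> f \<^bold>: Arr A B \<Longrightarrow> \<G> \<Turnstile> a \<^bold>: A \<Longrightarrow> \<G> \<Turnstile> App f a \<^bold>: B"
  unfolding Arr_def by (erule stable_pi_elim) (auto simp: wk_def)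

lemma stable_prod_form: "\<G> \<Turnstile> A \<^bold>: Uni i \<Longrightarrow> \<G> \<Turnstile> B \<^bold>: Uni i \<Longrightarrow> \<G> \<Turnstile> Prod A B \<^bold>: Uni i"
  unfolding Prod_def by (rule stable_sig_form) (auto intro: stable_wk' simp: wk_def)

lemma stable_neg_form: "\<G> \<Turnstile> A \<^bold>: Uni i \<Longrightarrow> \<G> \<Turnstile> Neg A \<^bold>: Uni i"
  unfolding Neg_def by (intro stable_arr_form stable_empty_form)

text \<open>Recursion with a constant motive. It unpacks a dependent pair whenever the goal does not
  mention the pair, which avoids a dependent second projection.\<close>

lemma stable_sig_rec:
  assumes "\<G> \<Turnstile> A \<^bold>: Uni i" "A # \<G> \<Turnstile> B \<^bold>: Uni i" "\<G> \<Turnstile> C \<^bold>: Uni j"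
    "B # A # \<G> \<Turnstile> g \<^bold>: wk 2 C" "\<G> \<Turnstile> p \<^bold>: Sig A B"
  shows "\<G> \<Turnstile> IndSig (wk 1 C) g p \<^bold>: C"
proof (rule stable_sig_elim[OF assms(1,2) _ _ assms(5)])
  show "Sig A B # \<G> \<Turnstile> wk 1 C \<^bold>: Uni j"
    by (rule stable_wk'[OF assms(3)]) (simp_all add: wk_def)
  show "B # A # \<G> \<Turnstile> g \<^bold>: reix 2 (Pr (Var 1) (Var 0)) (wk 1 C)"
    using assms(4) by (simp add: reix_def wk_def)
qed (simp add: wk_def)

lemma stable_fst:
  assumes "\<G> \<Turnstile> A \<^bold>: Uni i" "A # \<G> \<Turnstile> B \<^bold>: Uni i" "\<G> \<Turnstile> p \<^bold>: Sig A B"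
  shows "\<G> \<Turnstile> IndSig (wk 1 A) (Var 1) p \<^bold>: A"
  by (rule stable_sig_rec[OF assms(1,2) assms(1) _ assms(3)])
    (rule stable_var, simp_all add: wk_def)

lemma stable_prod_fst:
  assumes "\<G> \<Turnstile> A \<^bold>: Uni i" "\<G> \<Turnstile> B \<^bold>: Uni i" "\<G> \<Turnstile> p \<^bold>: Prod A B"
  shows "\<G> \<Turnstile> IndSig (wk 1 A) (Var 1) p \<^bold>: A"
  by (rule stable_fst[OF assms(1) stable_wk'[OF assms(2)] assms(3)[unfolded Prod_def]])
    (simp_all add: wk_def)

lemma stable_prod_snd:
  assumes "\<G> \<Turnstile> A \<^bold>: Uni i" "\<G> \<Turnstile> B \<^bold>: Uni i" "\<G> \<Turnstile> p \<^bold>: Prod A B"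
  shows "\<G> \<Turnstile> IndSig (wk 1 B) (Var 0) p \<^bold>: B"
proof (rule stable_sig_rec[OF assms(1) _ assms(2) _ assms(3)[unfolded Prod_def]])
  show "A # \<G> \<Turnstile> wk 1 B \<^bold>: Uni i"
    by (rule stable_wk'[OF assms(2)]) (simp_all add: wk_def)
  show "wk 1 B # A # \<G> \<Turnstile> Var 0 \<^bold>: wk 2 B"
    by (rule stable_var) (simp_all add: wk_def)
qed

text \<open>Stated for an arbitrary pair of opposite maps, so that both clauses of
  \<open>isEquiv\<close> are instances: with the candidate inverse as the inner map for the right
  inverse, and as the outer map for the left inverse.\<close>

lemma stable_htpy_form:
  assumes "\<G> \<Turnstile> A \<^bold>: Uni i" "\<G> \<Turnstile> B \<^bold>: Uni i" "\<G> \<Turnstile> f \<^bold>: Arr A B" "\<G> \<Turnstile> g \<^bold>: Arr B A"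
  shows "\<G> \<Turnstile> Pi A (Id (wk 1 A) (App (wk 1 g) (App (wk 1 f) (Var 0))) (Var 0)) \<^bold>: Uni i"
proof (rule stable_pi_form[OF assms(1)])
  have A: "A # \<G> \<Turnstile> wk 1 A \<^bold>: Uni i"
    using stable_wk[OF assms(1), of A] by (simp add: wk_def)
  have f: "A # \<G> \<Turnstile> wk 1 f \<^bold>: Arr (wk 1 A) (wk 1 B)"
    using stable_wk[OF assms(3), of A] by (simp add: wk_def)
  have g: "A # \<G> \<Turnstile> wk 1 g \<^bold>: Arr (wk 1 B) (wk 1 A)"
    using stable_wk[OF assms(4), of A] by (simp add: wk_def)
  have x: "A # \<G> \<Turnstile> Var 0 \<^bold>: wk 1 A"
    by (rule stable_var) simp_all
  show "A # \<G> \<Turnstile> Id (wk 1 A) (App (wk 1 g) (App (wk 1 f) (Var 0))) (Var 0) \<^bold>: Uni i"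
    by (intro stable_id_form A x stable_arr_elim[OF g] stable_arr_elim[OF f])
qed

lemma stable_rinv_form:
  assumes "\<G> \<Turnstile> A \<^bold>: Uni i" "\<G> \<Turnstile> B \<^bold>: Uni i" "\<G> \<Turnstile> f \<^bold>: Arr A B"
  shows "Arr B A # \<G> \<Turnstile> Pi (wk 1 B) (Id (wk 2 B) (App (wk 2 f) (App (Var 1) (Var 0))) (Var 0)) \<^bold>: Uni i"
  using stable_htpy_form[of "Arr B A # \<G>" "wk 1 B" i "wk 1 A" "Var 0" "wk 1 f"]
    stable_wk[OF assms(1), of "Arr B A"] stable_wk[OF assms(2), of "Arr B A"]
    stable_wk[OF assms(3), of "Arr B A"] stable_var[of 0 "Arr B A # \<G>" "wk 1 (Arr B A)"]
  by (simp add: wk_def numeral_2_eq_2)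

lemma stable_linv_form:
  assumes "\<G> \<Turnstile> A \<^bold>: Uni i" "\<G> \<Turnstile> B \<^bold>: Uni i" "\<G> \<Turnstile> f \<^bold>: Arr A B"
  shows "Arr B A # \<G> \<Turnstile> Pi (wk 1 A) (Id (wk 2 A) (App (Var 1) (App (wk 2 f) (Var 0))) (Var 0)) \<^bold>: Uni i"
  using stable_htpy_form[of "Arr B A # \<G>" "wk 1 A" i "wk 1 B" "wk 1 f" "Var 0"]
    stable_wk[OF assms(1), of "Arr B A"] stable_wk[OF assms(2), of "Arr B A"]
    stable_wk[OF assms(3), of "Arr B A"] stable_var[of 0 "Arr B A # \<G>" "wk 1 (Arr B A)"]
  by (simp add: wk_def numeral_2_eq_2)

lemma stable_isEquiv_form:
  assumes "\<G> \<Turnstile> A \<^bold>: Uni i" "\<G> \<Turnstile> B \<^bold>: Uni i" "\<G> \<Turnstile> f \<^bold>: Arr A B"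
  shows "\<G> \<Turnstile> isEquiv A B f \<^bold>: Uni i"
  unfolding isEquiv_def
  by (intro stable_prod_form stable_sig_form stable_arr_form stable_rinv_form stable_linv_form assms)

lemma stable_isEquiv_var:
  assumes "\<G> \<Turnstile> A \<^bold>: Uni i" "\<G> \<Turnstile> B \<^bold>: Uni i"
  shows "Arr A B # \<G> \<Turnstile> isEquiv (wk 1 A) (wk 1 B) (Var 0) \<^bold>: Uni i"
  using stable_wk[OF assms(1), of "Arr A B"] stable_wk[OF assms(2), of "Arr A B"]
    stable_var[of 0 "Arr A B # \<G>" "wk 1 (Arr A B)"]
  by (intro stable_isEquiv_form) (simp_all add: wk_def)

lemma stable_Equiv_form: "\<G> \<Turnstile> A \<^bold>: Uni i \<Longrightarrow> \<G> \<Turnstile> B \<^bold>: Uni i \<Longrightarrow> \<G> \<Turnstile> Equiv A B \<^bold>: Uni i"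
  unfolding Equiv_def by (intro stable_sig_form stable_arr_form stable_isEquiv_var)

lemma stable_isContr_form:
  assumes "\<G> \<Turnstile> A \<^bold>: Uni i"
  shows "\<G> \<Turnstile> isContr A \<^bold>: Uni i"
  unfolding isContr_def
proof (intro stable_sig_form stable_pi_form stable_id_form assms)
  show A1: "A # \<G> \<Turnstile> wk 1 A \<^bold>: Uni i"
    using stable_wk[OF assms, of A] by (simp add: wk_def)
  show "wk 1 A # A # \<G> \<Turnstile> wk 2 A \<^bold>: Uni i"
    using stable_wk[OF A1, of "wk 1 A"] by (simp add: wk_def)
qed (rule stable_var, simp_all add: wk_def)+

text \<open>The map is the section in the first half of the bi-invertibility data.\<close>

lemma isEquiv_inverse:
  assumes "\<G> \<Turnstile> A \<^bold>: Uni i" "\<G> \<Turnstile> B \<^bold>: Uni i" "\<G> \<Turnstile> f \<^bold>: Arr A B" "\<G> \<Turnstile> e \<^bold>: isEquiv A B f"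
  shows "\<exists>g. \<G> \<Turnstile> g \<^bold>: Arr B A"
  using stable_fst[OF stable_arr_form[OF assms(2,1)] stable_rinv_form[OF assms(1-3)]
      stable_prod_fst[OF
        stable_sig_form[OF stable_arr_form[OF assms(2,1)] stable_rinv_form[OF assms(1-3)]]
        stable_sig_form[OF stable_arr_form[OF assms(2,1)] stable_linv_form[OF assms(1-3)]]
        assms(4)[unfolded isEquiv_def]]]
  by blast

text \<open>The type \<open>Arr B A\<close> does not depend on the equivalence, so it suffices to
  find the inverse for a generic pair of a map and its invertibility, and then to apply
  recursion.\<close>

lemma Equiv_inverse:
  assumes "\<G> \<Turnstile> A \<^bold>: Uni i" "\<G> \<Turnstile> B \<^bold>: Uni i" "\<G> \<Turnstile> e \<^bold>: Equiv A B"
  shows "\<exists>g. \<G> \<Turnstile> g \<^bold>: Arr B A"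
proof -
  let ?E = "isEquiv (wk 1 A) (wk 1 B) (Var 0)"
  let ?\<G> = "?E # Arr A B # \<G>"
  have A: "?\<G> \<Turnstile> wk 2 A \<^bold>: Uni i" and B: "?\<G> \<Turnstile> wk 2 B \<^bold>: Uni i"
    using stable_wk[OF stable_wk[OF assms(1)], of ?E "Arr A B"]
      stable_wk[OF stable_wk[OF assms(2)], of ?E "Arr A B"] by (simp_all add: wk_def)
  have f: "?\<G> \<Turnstile> Var 1 \<^bold>: Arr (wk 2 A) (wk 2 B)"
    by (rule stable_var) (simp_all add: wk_def)
  have e: "?\<G> \<Turnstile> Var 0 \<^bold>: isEquiv (wk 2 A) (wk 2 B) (Var 1)"
    by (rule stable_var) (simp_all add: wk_def)
  obtain g where g: "?\<G> \<Turnstile> g \<^bold>: wk 2 (Arr B A)"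
    using isEquiv_inverse[OF A B f e] by (auto simp: wk_def)
  show ?thesis
    using stable_sig_rec[OF stable_arr_form[OF assms(1,2)] stable_isEquiv_var[OF assms(1,2)]
        stable_arr_form[OF assms(2,1)] g assms(3)[unfolded Equiv_def]] by blast
qed

subsection \<open>Two objects without morphisms between them\<close>

text \<open>The core, detached from categories: \<open>P\<close> and \<open>Q\<close> stand for the
  two hom types, \<open>X\<close> and \<open>Y\<close> for the realisations of the two
  objects.\<close>

lemma empty_homs_absurd:
  assumes X: "\<G> \<Turnstile> X \<^bold>: Uni i" and Y: "\<G> \<Turnstile> Y \<^bold>: Uni i"
    and P: "\<G> \<Turnstile> P \<^bold>: Uni i" and Q: "\<G> \<Turnstile> Q \<^bold>: Uni i"
    and e: "\<G> \<Turnstile> e \<^bold>: Equiv P (Arr X Y)" and e': "\<G> \<Turnstile> e' \<^bold>: Equiv Q (Arr Y X)"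
    and n: "\<G> \<Turnstile> n \<^bold>: Neg P" and n': "\<G> \<Turnstile> n' \<^bold>: Neg Q"
  shows "\<exists>t. \<G> \<Turnstile> t \<^bold>: Empty"
proof -
  obtain g where g: "\<G> \<Turnstile> g \<^bold>: Arr (Arr X Y) P"
    using Equiv_inverse[OF P stable_arr_form[OF X Y] e] by blast
  obtain g' where g': "\<G> \<Turnstile> g' \<^bold>: Arr (Arr Y X) Q"
    using Equiv_inverse[OF Q stable_arr_form[OF Y X] e'] by blast
  have wX: "Y # \<G> \<Turnstile> wk 1 X \<^bold>: Uni i"
    using stable_wk[OF X, of Y] by (simp add: wk_def)
  have wg: "Y # \<G> \<Turnstile> wk 1 g \<^bold>: Arr (Arr (wk 1 X) (wk 1 Y)) (wk 1 P)"
    using stable_wk[OF g, of Y] by (simp add: wk_def)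
  have wn: "Y # \<G> \<Turnstile> wk 1 n \<^bold>: Arr (wk 1 P) Empty"
    using stable_wk[OF n, of Y] by (simp add: wk_def Neg_def)
  \<comment> \<open>\<open>Var 1\<close> skips the argument in \<open>X\<close> and names the
    assumed element of \<open>Y\<close>, so its abstraction is the constant map.\<close>
  have "wk 1 X # Y # \<G> \<Turnstile> Var 1 \<^bold>: wk 1 (wk 1 Y)"
    by (rule stable_var) (simp_all add: wk_def)
  \<comment> \<open>A term of type \<open>X\<close>, still depending on the element of
    \<open>Y\<close>; abstracting that variable below yields the map in the other direction.\<close>
  note stable_empty_elim[OF wX
      stable_arr_elim[OF wn stable_arr_elim[OF wg stable_arr_intro[OF wX this]]]]
  note stable_arr_elim[OF n'[unfolded Neg_def]
      stable_arr_elim[OF g' stable_arr_intro[OF Y this]]]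
  then show ?thesis by blast
qed

subsection \<open>0-concrete categories on two points\<close>

text \<open>The innermost layer of \<open>ConcCat0\<close> with its dependencies as parameters
  instead of fixed indices, so that renaming and substitution act on the arguments only.
  \<open>HomT\<close>, \<open>TwoPointsAt\<close> and the later telescopes follow the same
  pattern.\<close>

definition ConfT :: "tm \<Rightarrow> tm \<Rightarrow> tm \<Rightarrow> tm"
  where "ConfT ob r h =
    Pi ob (Pi (wk 1 ob) (Equiv (App (App (wk 2 h) (Var 1)) (Var 0))
      (Arr (App (wk 2 r) (Var 1)) (App (wk 2 r) (Var 0)))))"

definition HomT :: "nat \<Rightarrow> tm \<Rightarrow> tm"
  where "HomT i ob = Arr ob (Arr ob (Uni i))"

lemma ren_ConfT [simp]: "ren s (ConfT ob r h) = ConfT (ren s ob) (ren s r) (ren s h)"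
  by (simp add: ConfT_def wk_def numeral_2_eq_2)

lemma subst_ConfT [simp]: "subst s (ConfT ob r h) = ConfT (subst s ob) (subst s r) (subst s h)"
  by (simp add: ConfT_def wk_def numeral_2_eq_2)

lemma ren_HomT [simp]: "ren s (HomT i ob) = HomT i (ren s ob)"
  by (simp add: HomT_def)

lemma subst_HomT [simp]: "subst s (HomT i ob) = HomT i (subst s ob)"
  by (simp add: HomT_def)

text \<open>Families valued in \<open>Uni i\<close> live one universe higher, so \<open>ob\<close>
  is lifted by cumulativity to match.\<close>

lemma stable_HomT_form: "\<G> \<Turnstile> ob \<^bold>: Uni i \<Longrightarrow> \<G> \<Turnstile> HomT i ob \<^bold>: Uni (Suc i)"
  unfolding HomT_def by (intro stable_arr_form stable_cumul stable_uni)

lemma stable_RealT_form: "\<G> \<Turnstile> ob \<^bold>: Uni i \<Longrightarrow> \<G> \<Turnstile> Arr ob (Uni i) \<^bold>: Uni (Suc i)"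
  by (intro stable_arr_form stable_cumul stable_uni)

lemma stable_hom:
  "\<G> \<Turnstile> h \<^bold>: HomT i ob \<Longrightarrow> \<G> \<Turnstile> a \<^bold>: ob \<Longrightarrow> \<G> \<Turnstile> b \<^bold>: ob \<Longrightarrow> \<G> \<Turnstile> App (App h a) b \<^bold>: Uni i"
  unfolding HomT_def by (blast intro: stable_arr_elim)

lemma stable_ConfT_form:
  assumes ob: "\<G> \<Turnstile> ob \<^bold>: Uni i" and r: "\<G> \<Turnstile> r \<^bold>: Arr ob (Uni i)" and h: "\<G> \<Turnstile> h \<^bold>: HomT i ob"
  shows "\<G> \<Turnstile> ConfT ob r h \<^bold>: Uni i"
proof -
  let ?\<G> = "wk 1 ob # ob # \<G>"
  have o1: "ob # \<G> \<Turnstile> wk 1 ob \<^bold>: Uni i"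
    using stable_wk[OF ob, of ob] by (simp add: wk_def)
  have r2: "?\<G> \<Turnstile> wk 2 r \<^bold>: Arr (wk 2 ob) (Uni i)"
    using stable_wk[OF stable_wk[OF r], of "wk 1 ob" ob] by (simp add: wk_def)
  have h2: "?\<G> \<Turnstile> wk 2 h \<^bold>: HomT i (wk 2 ob)"
    using stable_wk[OF stable_wk[OF h], of "wk 1 ob" ob] by (simp add: wk_def)
  have v: "?\<G> \<Turnstile> Var 0 \<^bold>: wk 2 ob" "?\<G> \<Turnstile> Var 1 \<^bold>: wk 2 ob"
    by (rule stable_var, simp_all add: wk_def)+
  show ?thesis
    unfolding ConfT_def
    by (intro stable_pi_form stable_Equiv_form stable_arr_form ob o1
        stable_hom[OF h2] stable_arr_elim[OF r2] v)
qed

lemma stable_conf: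
  assumes "\<G> \<Turnstile> c \<^bold>: ConfT ob r h" "\<G> \<Turnstile> a \<^bold>: ob" "\<G> \<Turnstile> b \<^bold>: ob"
  shows "\<G> \<Turnstile> App (App c a) b \<^bold>: Equiv (App (App h a) b) (Arr (App r a) (App r b))"
proof (rule stable_pi_elim[OF stable_pi_elim[OF assms(1)[unfolded ConfT_def] assms(2) refl, unfolded subst.simps]])
  show "\<G> \<Turnstile> b \<^bold>: sub1 a (wk 1 ob)"
    using assms(3) by (simp add: wk_def)
qed (simp add: wk_def numeral_2_eq_2)

definition TwoPointsAt :: "tm \<Rightarrow> tm \<Rightarrow> tm \<Rightarrow> tm"
  where "TwoPointsAt ob h f =
    (let x = App f (InL Star); y = App f (InR Star); H = (\<lambda>a b. App (App h a) b)
     in Prod (isEquiv Two ob f) (Prod (isContr (H x x)) (Prod (isContr (H y y))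
          (Prod (Neg (H x y)) (Neg (H y x))))))"

lemma TwoPointsOn_alt: "TwoPointsOn ob h = Sig (Arr Two ob) (TwoPointsAt (wk 1 ob) (wk 1 h) (Var 0))"
  by (simp add: TwoPointsOn_def TwoPointsAt_def)

lemma ren_TwoPointsAt: "ren r (TwoPointsAt ob h f) = TwoPointsAt (ren r ob) (ren r h) (ren r f)"
  by (simp add: TwoPointsAt_def Let_def)

lemma stable_two_points:
  assumes "\<G> \<Turnstile> f \<^bold>: Arr Two ob"
  shows "\<G> \<Turnstile> App f (InL Star) \<^bold>: ob" "\<G> \<Turnstile> App f (InR Star) \<^bold>: ob"
  by (intro stable_arr_elim[OF assms] stable_two_intro)+

lemma stable_TwoPointsAt_form:
  assumes "\<G> \<Turnstile> ob \<^bold>: Uni i" "\<G> \<Turnstile> h \<^bold>: HomT i ob" "\<G> \<Turnstile> f \<^bold>: Arr Two ob"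
  shows "\<G> \<Turnstile> TwoPointsAt ob h f \<^bold>: Uni i"
  unfolding TwoPointsAt_def Let_def 
  by (intro stable_prod_form stable_isEquiv_form stable_isContr_form
      stable_neg_form stable_two_form stable_hom[OF assms(2)]
      stable_two_points[OF assms(3)] assms)

lemma stable_TwoPointsAt_var:
  assumes "\<G> \<Turnstile> ob \<^bold>: Uni i" "\<G> \<Turnstile> h \<^bold>: HomT i ob"
  shows "Arr Two ob # \<G> \<Turnstile> TwoPointsAt (wk 1 ob) (wk 1 h) (Var 0) \<^bold>: Uni i"
  using stable_wk[OF assms(1), of "Arr Two ob"] stable_wk[OF assms(2), of "Arr Two ob"]
    stable_var[of 0 "Arr Two ob # \<G>" "wk 1 (Arr Two ob)"]
  by (intro stable_TwoPointsAt_form) (simp_all add: wk_def)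

lemma stable_TwoPointsOn_form:
  "\<G> \<Turnstile> ob \<^bold>: Uni i \<Longrightarrow> \<G> \<Turnstile> h \<^bold>: HomT i ob \<Longrightarrow> \<G> \<Turnstile> TwoPointsOn ob h \<^bold>: Uni i"
  unfolding TwoPointsOn_alt
  by (intro stable_sig_form stable_arr_form stable_two_form stable_TwoPointsAt_var)

lemma TwoPointsAt_absurd:
  assumes ob: "\<G> \<Turnstile> ob \<^bold>: Uni i" and r: "\<G> \<Turnstile> r \<^bold>: Arr ob (Uni i)" and h: "\<G> \<Turnstile> h \<^bold>: HomT i ob"
    and c: "\<G> \<Turnstile> c \<^bold>: ConfT ob r h" and f: "\<G> \<Turnstile> f \<^bold>: Arr Two ob" and q: "\<G> \<Turnstile> q \<^bold>: TwoPointsAt ob h f"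
  shows "\<exists>t. \<G> \<Turnstile> t \<^bold>: Empty"
proof -
  let ?x = "App f (InL Star)" and ?y = "App f (InR Star)"
  note x = stable_two_points(1)[OF f] and y = stable_two_points(2)[OF f]
  note E = stable_isEquiv_form[OF stable_two_form ob f]
  note Cx = stable_isContr_form[OF stable_hom[OF h x x]]
    and Cy = stable_isContr_form[OF stable_hom[OF h y y]]
  note N = stable_neg_form[OF stable_hom[OF h x y]] stable_neg_form[OF stable_hom[OF h y x]]
  note Ns = stable_prod_form[OF N]
  note CyNs = stable_prod_form[OF Cy Ns]
  \<comment> \<open>Three second projections descend to the innermost product, so \<open>p\<close>
    is the pair of the two negations.\<close>
  note p = stable_prod_snd[OF Cy Ns stable_prod_snd[OF Cx CyNs
        stable_prod_snd[OF E stable_prod_form[OF Cx CyNs] q[unfolded TwoPointsAt_def Let_def]]]]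
  show ?thesis
    by (rule empty_homs_absurd[OF stable_arr_elim[OF r x] stable_arr_elim[OF r y]
          stable_hom[OF h x y] stable_hom[OF h y x] stable_conf[OF c x y] stable_conf[OF c y x]
          stable_prod_fst[OF N p] stable_prod_snd[OF N p]])
qed

text \<open>The goal \<open>Empty\<close> is constant, so recursion on \<open>q\<close> supplies the
  map from \<open>Two\<close> and its properties as variables; all other data are weakened past
  these two.\<close>

lemma TwoPointsOn_absurd:
  assumes ob: "\<G> \<Turnstile> ob \<^bold>: Uni i" and r: "\<G> \<Turnstile> r \<^bold>: Arr ob (Uni i)" and h: "\<G> \<Turnstile> h \<^bold>: HomT i ob"
    and c: "\<G> \<Turnstile> c \<^bold>: ConfT ob r h" and q: "\<G> \<Turnstile> q \<^bold>: TwoPointsOn ob h"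
  shows "\<exists>t. \<G> \<Turnstile> t \<^bold>: Empty"
proof -
  let ?A = "Arr Two ob"
  let ?B = "TwoPointsAt (wk 1 ob) (wk 1 h) (Var 0)"
  let ?\<G> = "?B # ?A # \<G>"
  have w: "?\<G> \<Turnstile> wk 2 ob \<^bold>: Uni i" "?\<G> \<Turnstile> wk 2 r \<^bold>: Arr (wk 2 ob) (Uni i)"
    "?\<G> \<Turnstile> wk 2 h \<^bold>: HomT i (wk 2 ob)" "?\<G> \<Turnstile> wk 2 c \<^bold>: ConfT (wk 2 ob) (wk 2 r) (wk 2 h)"
    using stable_wk[OF stable_wk[OF ob], of ?B ?A] stable_wk[OF stable_wk[OF r], of ?B ?A]
      stable_wk[OF stable_wk[OF h], of ?B ?A] stable_wk[OF stable_wk[OF c], of ?B ?A]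
    by (simp_all add: wk_def)
  have "?\<G> \<Turnstile> Var 1 \<^bold>: Arr Two (wk 2 ob)" "?\<G> \<Turnstile> Var 0 \<^bold>: TwoPointsAt (wk 2 ob) (wk 2 h) (Var 1)"
    by (rule stable_var, simp_all add: wk_def ren_TwoPointsAt)+
  from TwoPointsAt_absurd[OF w this] obtain t where t: "?\<G> \<Turnstile> t \<^bold>: wk 2 Empty"
    by (auto simp: wk_def)
  show ?thesis
    using stable_sig_rec[OF stable_arr_form[OF stable_two_form ob] stable_TwoPointsAt_var[OF ob h]
        stable_empty_form t q[unfolded TwoPointsOn_alt]] by blast
qed

section \<open>Categories as nested Sigma-types, and the eliminations on them\<close>

definition HomConf :: "nat \<Rightarrow> tm \<Rightarrow> tm \<Rightarrow> tm"
  where "HomConf i ob r = Sig (HomT i ob) (ConfT (wk 1 ob) (wk 1 r) (Var 0))"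

definition RealHomConf :: "nat \<Rightarrow> tm \<Rightarrow> tm"
  where "RealHomConf i ob = Sig (Arr ob (Uni i)) (HomConf i (wk 1 ob) (Var 0))"

text \<open>What is left of \<open>IsTwoPoints\<close> once the objects and the realisation map have
  been split off; \<open>p\<close> stands for the remaining pair. \<open>TwoPointsReal\<close> is
  the stage before, with only the objects split off.\<close>

definition TwoPointsHom :: "nat \<Rightarrow> tm \<Rightarrow> tm \<Rightarrow> tm"
  where "TwoPointsHom i ob p = IndSig (Uni i) (TwoPointsOn (wk 2 ob) (Var 1)) p"

definition TwoPointsReal :: "nat \<Rightarrow> tm \<Rightarrow> tm \<Rightarrow> tm"
  where "TwoPointsReal i ob p = IndSig (Uni i) (TwoPointsHom i (wk 2 ob) (Var 0)) p"

lemma ConcCat0_alt: "ConcCat0 i = Sig (Uni i) (RealHomConf i (Var 0))"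
  by (simp add: ConcCat0_def RealHomConf_def HomConf_def HomT_def ConfT_def wk_def numeral_eq_Suc)

text \<open>The index 5 of the objects in \<open>IsTwoPoints\<close> is the index 1 weakened by 2 at
  each of the two inner eliminations.\<close>

lemma IsTwoPoints_alt: "IsTwoPoints i K = IndSig (Uni i) (TwoPointsReal i (Var 1) (Var 0)) K"
  by (simp add: IsTwoPoints_def TwoPointsReal_def TwoPointsHom_def wk_def numeral_eq_Suc)

lemma ren_components [simp]:
  "ren s (HomConf i ob r) = HomConf i (ren s ob) (ren s r)"
  "ren s (RealHomConf i ob) = RealHomConf i (ren s ob)"
  "ren s (TwoPointsHom i ob p) = TwoPointsHom i (ren s ob) (ren s p)"
  "ren s (TwoPointsReal i ob p) = TwoPointsReal i (ren s ob) (ren s p)"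
  "ren s (ConcCat0 i) = ConcCat0 i"
  "ren s (IsTwoPoints i p) = IsTwoPoints i (ren s p)"
  by (simp_all add: ConcCat0_alt IsTwoPoints_alt HomConf_def RealHomConf_def TwoPointsHom_def
      TwoPointsReal_def wk_def)

lemma subst_components [simp]:
  "subst s (HomConf i ob r) = HomConf i (subst s ob) (subst s r)"
  "subst s (RealHomConf i ob) = RealHomConf i (subst s ob)"
  "subst s (TwoPointsHom i ob p) = TwoPointsHom i (subst s ob) (subst s p)"
  "subst s (TwoPointsReal i ob p) = TwoPointsReal i (subst s ob) (subst s p)"
  "subst s (ConcCat0 i) = ConcCat0 i"
  "subst s (IsTwoPoints i p) = IsTwoPoints i (subst s p)"
  by (simp_all add: ConcCat0_alt IsTwoPoints_alt HomConf_def RealHomConf_def TwoPointsHom_def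
      TwoPointsReal_def wk_def)

lemma stable_ConfT_var:
  assumes "\<G> \<Turnstile> ob \<^bold>: Uni i" "\<G> \<Turnstile> r \<^bold>: Arr ob (Uni i)"
  shows "HomT i ob # \<G> \<Turnstile> ConfT (wk 1 ob) (wk 1 r) (Var 0) \<^bold>: Uni (Suc i)"
  using stable_wk[OF assms(1), of "HomT i ob"] stable_wk[OF assms(2), of "HomT i ob"]
    stable_var[of 0 "HomT i ob # \<G>" "wk 1 (HomT i ob)"]
  by (intro stable_cumul stable_ConfT_form) (simp_all add: wk_def)

lemma stable_HomConf_form:
  "\<G> \<Turnstile> ob \<^bold>: Uni i \<Longrightarrow> \<G> \<Turnstile> r \<^bold>: Arr ob (Uni i) \<Longrightarrow> \<G> \<Turnstile> HomConf i ob r \<^bold>: Uni (Suc i)"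
  unfolding HomConf_def by (intro stable_sig_form stable_HomT_form stable_ConfT_var)

lemma stable_HomConf_var:
  assumes "\<G> \<Turnstile> ob \<^bold>: Uni i"
  shows "Arr ob (Uni i) # \<G> \<Turnstile> HomConf i (wk 1 ob) (Var 0) \<^bold>: Uni (Suc i)"
  using stable_wk[OF assms, of "Arr ob (Uni i)"]
    stable_var[of 0 "Arr ob (Uni i) # \<G>" "wk 1 (Arr ob (Uni i))"]
  by (intro stable_HomConf_form) (simp_all add: wk_def)

lemma stable_RealHomConf_form:
  "\<G> \<Turnstile> ob \<^bold>: Uni i \<Longrightarrow> \<G> \<Turnstile> RealHomConf i ob \<^bold>: Uni (Suc i)"
  unfolding RealHomConf_def by (intro stable_sig_form stable_RealT_form stable_HomConf_var)

lemma stable_RealHomConf_var: "Uni i # \<G> \<Turnstile> RealHomConf i (Var 0) \<^bold>: Uni (Suc i)"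
  by (rule stable_RealHomConf_form[OF stable_var]) (simp_all add: wk_def)

lemma stable_ConcCat0_form: "\<G> \<Turnstile> ConcCat0 i \<^bold>: Uni (Suc i)"
  unfolding ConcCat0_alt by (intro stable_sig_form stable_uni stable_RealHomConf_var)

lemma stable_HomConf_intro:
  assumes "\<G> \<Turnstile> ob \<^bold>: Uni i" "\<G> \<Turnstile> r \<^bold>: Arr ob (Uni i)" "\<G> \<Turnstile> h \<^bold>: HomT i ob" "\<G> \<Turnstile> c \<^bold>: ConfT ob r h"
  shows "\<G> \<Turnstile> Pr h c \<^bold>: HomConf i ob r"
  unfolding HomConf_def
  by (rule stable_sig_intro[OF stable_HomT_form[OF assms(1)] stable_ConfT_var[OF assms(1,2)] assms(3)])
    (use assms(4) in \<open>simp add: wk_def\<close>)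

lemma stable_RealHomConf_intro:
  assumes "\<G> \<Turnstile> ob \<^bold>: Uni i" "\<G> \<Turnstile> r \<^bold>: Arr ob (Uni i)" "\<G> \<Turnstile> p \<^bold>: HomConf i ob r"
  shows "\<G> \<Turnstile> Pr r p \<^bold>: RealHomConf i ob"
  unfolding RealHomConf_def
  by (rule stable_sig_intro[OF stable_RealT_form[OF assms(1)] stable_HomConf_var[OF assms(1)] assms(2)])
    (use assms(3) in \<open>simp add: wk_def\<close>)

lemma stable_ConcCat0_intro:
  assumes "\<G> \<Turnstile> ob \<^bold>: Uni i" "\<G> \<Turnstile> p \<^bold>: RealHomConf i ob"
  shows "\<G> \<Turnstile> Pr ob p \<^bold>: ConcCat0 i"
  unfolding ConcCat0_alt
  by (rule stable_sig_intro[OF stable_uni stable_RealHomConf_var assms(1)])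
    (use assms(2) in \<open>simp add: wk_def\<close>)

lemma stable_TwoPointsOn_var:
  assumes "\<G> \<Turnstile> ob \<^bold>: Uni i"
  shows "C # HomT i ob # \<G> \<Turnstile> TwoPointsOn (wk 2 ob) (Var 1) \<^bold>: Uni i"
  using stable_wk2[OF assms, of C "HomT i ob"]
    stable_var[of 1 "C # HomT i ob # \<G>" "wk 2 (HomT i ob)"]
  by (intro stable_TwoPointsOn_form) (simp_all add: wk_def)

text \<open>The constant motive is the universe \<open>Uni i\<close>, itself typed in
  \<open>Uni (Suc i)\<close>, so the elimination rule yields a type in \<open>Uni i\<close>.\<close>

lemma stable_TwoPointsHom_form:
  assumes "\<G> \<Turnstile> ob \<^bold>: Uni i" "\<G> \<Turnstile> r \<^bold>: Arr ob (Uni i)" "\<G> \<Turnstile> p \<^bold>: HomConf i ob r"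
  shows "\<G> \<Turnstile> TwoPointsHom i ob p \<^bold>: Uni i"
  unfolding TwoPointsHom_def
  by (rule stable_sig_elim[OF stable_HomT_form[OF assms(1)] stable_ConfT_var[OF assms(1,2)]
        stable_uni _ assms(3)[unfolded HomConf_def]])
    (use stable_TwoPointsOn_var[OF assms(1)] in \<open>simp_all add: reix_def\<close>)

lemma stable_TwoPointsHom_var:
  assumes "\<G> \<Turnstile> ob \<^bold>: Uni i"
  shows "HomConf i (wk 1 ob) (Var 0) # Arr ob (Uni i) # \<G> \<Turnstile> TwoPointsHom i (wk 2 ob) (Var 0) \<^bold>: Uni i"
    (is "?\<G> \<Turnstile> _ \<^bold>: _")
  using stable_wk2[OF assms, of "HomConf i (wk 1 ob) (Var 0)" "Arr ob (Uni i)"]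
    stable_var[of 1 ?\<G> "wk 2 (Arr ob (Uni i))"]
    stable_var[of 0 ?\<G> "HomConf i (wk 2 ob) (Var 1)"]
  by (intro stable_TwoPointsHom_form[of _ _ _ "Var 1"]) (simp_all add: wk_def)

lemma stable_TwoPointsReal_form:
  assumes "\<G> \<Turnstile> ob \<^bold>: Uni i" "\<G> \<Turnstile> p \<^bold>: RealHomConf i ob"
  shows "\<G> \<Turnstile> TwoPointsReal i ob p \<^bold>: Uni i"
  unfolding TwoPointsReal_def
  by (rule stable_sig_elim[OF stable_RealT_form[OF assms(1)] stable_HomConf_var[OF assms(1)]
        stable_uni _ assms(2)[unfolded RealHomConf_def]])
    (use stable_TwoPointsHom_var[OF assms(1)] in \<open>simp_all add: reix_def\<close>)

lemma stable_TwoPointsReal_var: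
  "RealHomConf i (Var 0) # Uni i # \<G> \<Turnstile> TwoPointsReal i (Var 1) (Var 0) \<^bold>: Uni i"
  by (rule stable_TwoPointsReal_form; rule stable_var) (simp_all add: wk_def)

lemma stable_IsTwoPoints_form:
  assumes "\<G> \<Turnstile> K \<^bold>: ConcCat0 i"
  shows "\<G> \<Turnstile> IsTwoPoints i K \<^bold>: Uni i"
  unfolding IsTwoPoints_alt
  by (rule stable_sig_elim[OF stable_uni stable_RealHomConf_var stable_uni _
        assms[unfolded ConcCat0_alt]])
    (use stable_TwoPointsReal_var in \<open>simp_all add: reix_def\<close>)

section \<open>Contradictions at each layer of the elimination\<close>

text \<open>
  The hypothesis \<open>q\<close> has to be carried through the elimination of \<open>p\<close>, by the motive \<open>F \<rightarrow> \<zero>\<close>: its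
  type is a large elimination of \<open>p\<close>, which computes only when \<open>p\<close> is a pair.
\<close>

lemma sig_absurd:
  assumes A: "\<G> \<Turnstile> A \<^bold>: Uni i" and B: "A # \<G> \<Turnstile> B \<^bold>: Uni i"
    and F: "Sig A B # \<G> \<Turnstile> F \<^bold>: Uni j" and F': "B # A # \<G> \<Turnstile> F' \<^bold>: Uni j"
    and eq: "reix 2 (Pr (Var 1) (Var 0)) F = F'"
    and t: "\<exists>t. F' # B # A # \<G> \<Turnstile> t \<^bold>: Empty"
    and p: "\<G> \<Turnstile> p \<^bold>: Sig A B" and q: "\<G> \<Turnstile> q \<^bold>: sub1 p F"
  shows "\<exists>t. \<G> \<Turnstile> t \<^bold>: Empty"
proof -
  from t obtain t where t: "F' # B # A # \<G> \<Turnstile> t \<^bold>: Empty" ..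
  have "\<G> \<Turnstile> IndSig (Arr F Empty) (Lam F' t) p \<^bold>: Arr (sub1 p F) Empty"
  proof (rule stable_sig_elim[OF A B _ _ p])
    show "Sig A B # \<G> \<Turnstile> Arr F Empty \<^bold>: Uni j"
      by (intro stable_arr_form F stable_empty_form)
    have "B # A # \<G> \<Turnstile> Lam F' t \<^bold>: Arr F' Empty"
      using t by (intro stable_arr_intro[OF F']) (simp add: wk_def)
    \<comment> \<open>The branch is typed by the motive at the generic pair, which \<open>eq\<close>
      identifies with \<open>Arr F' Empty\<close>.\<close>
    then show "B # A # \<G> \<Turnstile> Lam F' t \<^bold>: reix 2 (Pr (Var 1) (Var 0)) (Arr F Empty)"
      by (simp add: reix_def flip: eq)
  qed simp
  from stable_arr_elim[OF this q] show ?thesis by blast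
qed

text \<open>On an actual pair the type of \<open>q\<close> computes, and conversion turns
  \<open>q\<close> into an element of \<open>TwoPointsOn ob h\<close>.\<close>

lemma TwoPointsHom_pair_absurd:
  assumes ob: "\<G> \<Turnstile> ob \<^bold>: Uni i" and r: "\<G> \<Turnstile> r \<^bold>: Arr ob (Uni i)" and h: "\<G> \<Turnstile> h \<^bold>: HomT i ob"
    and c: "\<G> \<Turnstile> c \<^bold>: ConfT ob r h" and q: "\<G> \<Turnstile> q \<^bold>: TwoPointsHom i ob (Pr h c)"
  shows "\<exists>t. \<G> \<Turnstile> t \<^bold>: Empty"
proof -
  have "\<G> \<Turnstile> TwoPointsHom i ob (Pr h c) \<cong> TwoPointsOn ob h \<^bold>: Uni i"
    unfolding TwoPointsHom_def
    by (rule stable_sig_comp[OF stable_HomT_form[OF ob] stable_ConfT_var[OF ob r] stable_uni _ h])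
      (use c stable_TwoPointsOn_var[OF ob] in \<open>simp_all add: reix_def wk_def\<close>)
  from TwoPointsOn_absurd[OF ob r h c stable_conv[OF q this]] show ?thesis .
qed

lemma TwoPointsHom_absurd:
  assumes ob: "\<G> \<Turnstile> ob \<^bold>: Uni i" and r: "\<G> \<Turnstile> r \<^bold>: Arr ob (Uni i)" and p: "\<G> \<Turnstile> p \<^bold>: HomConf i ob r"
    and q: "\<G> \<Turnstile> q \<^bold>: TwoPointsHom i ob p"
  shows "\<exists>t. \<G> \<Turnstile> t \<^bold>: Empty"
proof (rule sig_absurd[OF stable_HomT_form[OF ob] stable_ConfT_var[OF ob r]])
  let ?A = "HomT i ob" and ?B = "ConfT (wk 1 ob) (wk 1 r) (Var 0)"
  let ?F' = "TwoPointsHom i (wk 2 ob) (Pr (Var 1) (Var 0))"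
  let ?\<G> = "?F' # ?B # ?A # \<G>"
  \<comment> \<open>The realisation map does not occur in \<open>TwoPointsHom\<close>, only in the
    type of its last argument; unification cannot find it, so its weakenings are prepared and
    instantiated by hand.\<close>
  note r1 = stable_wk[OF r, of "Sig ?A ?B"] and r2 = stable_wk2[OF r, of ?B ?A]
    and r3 = stable_wk3[OF r, of ?F' ?B ?A]
  have "Sig ?A ?B # \<G> \<Turnstile> Var 0 \<^bold>: HomConf i (wk 1 ob) (wk 1 r)"
    by (rule stable_var) (simp_all add: wk_def HomConf_def)
  with stable_wk[OF ob, of "Sig ?A ?B"] r1
  show "Sig ?A ?B # \<G> \<Turnstile> TwoPointsHom i (wk 1 ob) (Var 0) \<^bold>: Uni i"
    by (intro stable_TwoPointsHom_form[of _ _ _ "wk 1 r"]) (simp_all add: wk_def)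
  have "?B # ?A # \<G> \<Turnstile> Var 1 \<^bold>: HomT i (wk 2 ob)"
    "?B # ?A # \<G> \<Turnstile> Var 0 \<^bold>: ConfT (wk 2 ob) (wk 2 r) (Var 1)"
    by (rule stable_var, simp_all add: wk_def)+
  with stable_wk2[OF ob, of ?B ?A] r2 show "?B # ?A # \<G> \<Turnstile> ?F' \<^bold>: Uni i"
    by (intro stable_TwoPointsHom_form[of _ _ _ "wk 2 r"] stable_HomConf_intro) (simp_all add: wk_def)
  \<comment> \<open>The hypothesis of type \<open>?F'\<close> takes index 0, so the components of
    the generic pair move from 1 and 0 to 2 and 1.\<close>
  have "?\<G> \<Turnstile> Var 2 \<^bold>: HomT i (wk 3 ob)"
    "?\<G> \<Turnstile> Var 1 \<^bold>: ConfT (wk 3 ob) (wk 3 r) (Var 2)"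
    "?\<G> \<Turnstile> Var 0 \<^bold>: TwoPointsHom i (wk 3 ob) (Pr (Var 2) (Var 1))"
    by (rule stable_var, simp_all add: wk_def numeral_eq_Suc)+
  with stable_wk3[OF ob, of ?F' ?B ?A] r3 show "\<exists>t. ?\<G> \<Turnstile> t \<^bold>: Empty"
    by (intro TwoPointsHom_pair_absurd[of _ "wk 3 ob" i "wk 3 r" "Var 2" "Var 1" "Var 0"])
      (simp_all add: wk_def)
qed (use p q in \<open>simp_all add: reix_def wk_def HomConf_def\<close>)

lemma TwoPointsReal_pair_absurd:
  assumes ob: "\<G> \<Turnstile> ob \<^bold>: Uni i" and r: "\<G> \<Turnstile> r \<^bold>: Arr ob (Uni i)" and p: "\<G> \<Turnstile> p \<^bold>: HomConf i ob r"
    and q: "\<G> \<Turnstile> q \<^bold>: TwoPointsReal i ob (Pr r p)"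
  shows "\<exists>t. \<G> \<Turnstile> t \<^bold>: Empty"
proof -
  have "\<G> \<Turnstile> TwoPointsReal i ob (Pr r p) \<cong> TwoPointsHom i ob p \<^bold>: Uni i"
    unfolding TwoPointsReal_def
    by (rule stable_sig_comp[OF stable_RealT_form[OF ob] stable_HomConf_var[OF ob] stable_uni _ r])
      (use p stable_TwoPointsHom_var[OF ob] in \<open>simp_all add: reix_def wk_def\<close>)
  from TwoPointsHom_absurd[OF ob r p stable_conv[OF q this]] show ?thesis .
qed

text \<open>The scheme of \<open>TwoPointsHom_absurd\<close> one Sigma-type further out, where the
  first component is the realisation map.\<close>

lemma TwoPointsReal_absurd:
  assumes ob: "\<G> \<Turnstile> ob \<^bold>: Uni i" and p: "\<G> \<Turnstile> p \<^bold>: RealHomConf i ob"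
    and q: "\<G> \<Turnstile> q \<^bold>: TwoPointsReal i ob p"
  shows "\<exists>t. \<G> \<Turnstile> t \<^bold>: Empty"
proof (rule sig_absurd[OF stable_RealT_form[OF ob] stable_HomConf_var[OF ob]])
  let ?A = "Arr ob (Uni i)" and ?B = "HomConf i (wk 1 ob) (Var 0)"
  let ?F' = "TwoPointsReal i (wk 2 ob) (Pr (Var 1) (Var 0))"
  let ?\<G> = "?F' # ?B # ?A # \<G>"
  have "Sig ?A ?B # \<G> \<Turnstile> Var 0 \<^bold>: RealHomConf i (wk 1 ob)"
    by (rule stable_var) (simp_all add: wk_def RealHomConf_def)
  with stable_wk[OF ob, of "Sig ?A ?B"]
  show "Sig ?A ?B # \<G> \<Turnstile> TwoPointsReal i (wk 1 ob) (Var 0) \<^bold>: Uni i"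
    by (intro stable_TwoPointsReal_form) (simp_all add: wk_def)
  have "?B # ?A # \<G> \<Turnstile> Var 1 \<^bold>: Arr (wk 2 ob) (Uni i)"
    "?B # ?A # \<G> \<Turnstile> Var 0 \<^bold>: HomConf i (wk 2 ob) (Var 1)"
    by (rule stable_var, simp_all add: wk_def)+
  with stable_wk2[OF ob, of ?B ?A] show "?B # ?A # \<G> \<Turnstile> ?F' \<^bold>: Uni i"
    by (intro stable_TwoPointsReal_form stable_RealHomConf_intro) (simp_all add: wk_def)
  have "?\<G> \<Turnstile> Var 2 \<^bold>: Arr (wk 3 ob) (Uni i)"
    "?\<G> \<Turnstile> Var 1 \<^bold>: HomConf i (wk 3 ob) (Var 2)"
    "?\<G> \<Turnstile> Var 0 \<^bold>: TwoPointsReal i (wk 3 ob) (Pr (Var 2) (Var 1))"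
    by (rule stable_var, simp_all add: wk_def numeral_eq_Suc)+
  with stable_wk3[OF ob, of ?F' ?B ?A] show "\<exists>t. ?\<G> \<Turnstile> t \<^bold>: Empty"
    by (intro TwoPointsReal_pair_absurd[of _ "wk 3 ob" i "Var 2" "Var 1" "Var 0"])
      (simp_all add: wk_def)
qed (use p q in \<open>simp_all add: reix_def wk_def RealHomConf_def\<close>)

lemma IsTwoPoints_pair_absurd:
  assumes ob: "\<G> \<Turnstile> ob \<^bold>: Uni i" and p: "\<G> \<Turnstile> p \<^bold>: RealHomConf i ob"
    and q: "\<G> \<Turnstile> q \<^bold>: IsTwoPoints i (Pr ob p)"
  shows "\<exists>t. \<G> \<Turnstile> t \<^bold>: Empty"
proof -
  have "\<G> \<Turnstile> IsTwoPoints i (Pr ob p) \<cong> TwoPointsReal i ob p \<^bold>: Uni i"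
    unfolding IsTwoPoints_alt
    by (rule stable_sig_comp[OF stable_uni stable_RealHomConf_var stable_uni _ ob])
      (use p stable_TwoPointsReal_var in \<open>simp_all add: reix_def wk_def\<close>)
  from TwoPointsReal_absurd[OF ob p stable_conv[OF q this]] show ?thesis .
qed

text \<open>The outermost layer: the type of objects is itself a variable of type
  \<open>Uni i\<close>, so no ambient parameter has to be weakened.\<close>

lemma IsTwoPoints_absurd:
  assumes p: "\<G> \<Turnstile> K \<^bold>: ConcCat0 i" and q: "\<G> \<Turnstile> q \<^bold>: IsTwoPoints i K"
  shows "\<exists>t. \<G> \<Turnstile> t \<^bold>: Empty"
proof (rule sig_absurd[OF stable_uni stable_RealHomConf_var])
  let ?A = "Uni i" and ?B = "RealHomConf i (Var 0)"
  let ?F' = "IsTwoPoints i (Pr (Var 1) (Var 0))"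
  let ?\<G> = "?F' # ?B # ?A # \<G>"
  have "Sig ?A ?B # \<G> \<Turnstile> Var 0 \<^bold>: ConcCat0 i"
    by (rule stable_var) (simp_all add: wk_def flip: ConcCat0_alt)
  then show "Sig ?A ?B # \<G> \<Turnstile> IsTwoPoints i (Var 0) \<^bold>: Uni i"
    by (rule stable_IsTwoPoints_form)
  have "?B # ?A # \<G> \<Turnstile> Var 1 \<^bold>: Uni i" "?B # ?A # \<G> \<Turnstile> Var 0 \<^bold>: RealHomConf i (Var 1)"
    by (rule stable_var, simp_all add: wk_def)+
  then show "?B # ?A # \<G> \<Turnstile> ?F' \<^bold>: Uni i"
    by (intro stable_IsTwoPoints_form stable_ConcCat0_intro)
  have "?\<G> \<Turnstile> Var 2 \<^bold>: Uni i" "?\<G> \<Turnstile> Var 1 \<^bold>: RealHomConf i (Var 2)"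
    "?\<G> \<Turnstile> Var 0 \<^bold>: IsTwoPoints i (Pr (Var 2) (Var 1))"
    by (rule stable_var, simp_all add: wk_def numeral_eq_Suc)+
  then show "\<exists>t. ?\<G> \<Turnstile> t \<^bold>: Empty"
    by (rule IsTwoPoints_pair_absurd)
qed (use p q in \<open>simp_all add: reix_def wk_def flip: ConcCat0_alt\<close>)

theorem theorem1:
  fixes i :: nat
  shows "\<exists>t. [] \<turnstile> t \<^bold>: Neg (Sig (ConcCat0 i) (IsTwoPoints i (Var 0)))"
proof -
  let ?K = "ConcCat0 i" and ?T = "IsTwoPoints i (Var 0)"
  \<comment> \<open>\<open>?K\<close> is closed and \<open>?T\<close> mentions only the newest
    variable, so the same terms serve over the empty context and over the assumed pair.\<close>
  have K: "\<G> \<Turnstile> ?K \<^bold>: Uni (Suc i)" for \<G>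
    by (rule stable_ConcCat0_form)
  \<comment> \<open>\<open>IsTwoPoints\<close> already lies in \<open>Uni i\<close>; it is lifted
    because Sigma-formation wants both components in one universe.\<close>
  have T: "?K # \<G> \<Turnstile> ?T \<^bold>: Uni (Suc i)" for \<G>
    by (intro stable_cumul stable_IsTwoPoints_form stable_var) (simp_all add: wk_def)
  \<comment> \<open>The assumed pair comes first, then its generic components, as bound by the
    branch of the recursion on that pair.\<close>
  let ?\<G> = "?T # ?K # [Sig ?K ?T]"
  have "?\<G> \<Turnstile> Var 1 \<^bold>: ?K" "?\<G> \<Turnstile> Var 0 \<^bold>: IsTwoPoints i (Var 1)"
    by (rule stable_var, simp_all add: wk_def)+
  from IsTwoPoints_absurd[OF this] obtain t where t: "?\<G> \<Turnstile> t \<^bold>: wk 2 Empty"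
    by (auto simp: wk_def)
  have "[Sig ?K ?T] \<Turnstile> Var 0 \<^bold>: Sig ?K ?T"
    by (rule stable_var) (simp_all add: wk_def)
  from stable_sig_rec[OF K T stable_empty_form t this]
  have "[Sig ?K ?T] \<Turnstile> IndSig (wk 1 Empty) t (Var 0) \<^bold>: wk 1 Empty"
    by (simp add: wk_def)
  from stable_arr_intro[OF stable_sig_form[OF K T] this] show ?thesis
    unfolding Neg_def by (blast intro: stable_imp_typing)
qed

end
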